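(* Let $d,m,n$ be integers satisfying $1 \le d \le n$ and $dn-\binom{d}{2} + 1\le m\le\binom{n+1}{2}$. Let $E \subseteq \mathrm{Gr}(m,\mathcal{S}^n)$ consist of all linear spaces $L$ satisfying (1) $L$ contains a PSD matrix of rank $n-d$, and (2) $Z(\Omega)$ and $L$ intersect non-transversally for all PSD $\Omega \in L$ of rank $n-d$. Then $E$ lies inside a Zariski-closed proper subset of $\mathrm{Gr}(m,\mathcal{S}^n)$.
   Context: $\mathcal{S}^n$ is the vector space of real symmetric $n\times n$ matrices; PSD means positive semidefinite. $\mathrm{Gr}(m,\mathcal{S}^n)$ is the Grassmannian of $m$-dimensional linear subspaces of $\mathcal{S}^n$, viewed as a real projective variety via Plücker coordinates. For $\Omega\in\mathcal{S}^n$ of rank $n-d$, $Z(\Omega)$ is the set of all matrices in $\mathcal{S}^n$ with the same column span as $\Omega$; it is a Zariski-open dense subset of the linear space $\overline Z(\Omega)$ of all matrices in $\mathcal{S}^n$ whose column span is contained in that of $\Omega$. For $\Omega \in L$, $Z(\Omega)$ and $L$ intersect transversally if their tangent spaces at points of intersection together span $\mathcal{S}^n$, i.e. if $L+\overline Z(\Omega)=\mathcal{S}^n$; otherwise they intersect non-transversally. *)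

theory Defs
  imports "HOL-Analysis.Analysis" "HOL-Library.Poly_Mapping"
begin

section \<open>Symmetric matrices\<close>

definition sym_mats :: "(real ^ 'n ^ 'n) set" where
  "sym_mats = {A. transpose A = A}"

definition psd :: "real ^ 'n ^ 'n \<Rightarrow> bool" where
  "psd A \<longleftrightarrow> A \<in> sym_mats \<and> (\<forall>x. 0 \<le> x \<bullet> (A *v x))"

text \<open>\<open>Z_of \<Omega>\<close> consists of the symmetric matrices with the same column span as \<open>\<Omega>\<close>,
  \<open>Zbar_of \<Omega>\<close> is the linear space in which it is Zariski-open and dense.\<close>

definition Z_of :: "real ^ 'n ^ 'n \<Rightarrow> (real ^ 'n ^ 'n) set" where
  "Z_of \<Omega> = {A \<in> sym_mats. span (columns A) = span (columns \<Omega>)}"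

definition Zbar_of :: "real ^ 'n ^ 'n \<Rightarrow> (real ^ 'n ^ 'n) set" where
  "Zbar_of \<Omega> = {A \<in> sym_mats. span (columns A) \<subseteq> span (columns \<Omega>)}"

lemma Z_of_subset_Zbar_of: "Z_of \<Omega> \<subseteq> Zbar_of \<Omega>"
  by (auto simp: Z_of_def Zbar_of_def)

text \<open>Transversality of the intersection of \<open>Z_of \<Omega>\<close> and \<open>L\<close>. At every point of
  \<open>Z_of \<Omega> \<inter> L\<close> the tangent spaces are \<open>Zbar_of \<Omega>\<close> and \<open>L\<close> themselves, so the condition that
  they span the space of symmetric matrices does not depend on the point.\<close>

definition Z_transversal :: "real ^ 'n ^ 'n \<Rightarrow> (real ^ 'n ^ 'n) set \<Rightarrow> bool" where
  "Z_transversal \<Omega> L \<longleftrightarrow> {A + B | A B. A \<in> L \<and> B \<in> Zbar_of \<Omega>} = sym_mats"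


section \<open>The Grassmannian and its Zariski topology\<close>

definition grassmannian :: "nat \<Rightarrow> (real ^ 'n ^ 'n) set set" where
  "grassmannian m = {L. subspace L \<and> L \<subseteq> sym_mats \<and> dim L = m}"

text \<open>The \<open>I\<close>-th Pluecker coordinate of the ordered basis \<open>B\<close> is the maximal minor, with
  columns \<open>I\<close>, of the matrix whose rows are the entry vectors of the matrices \<open>B k\<close>.
  All tuples \<open>I\<close> of matrix positions are admitted as index: compared with increasing
  tuples of positions on or above the diagonal, this only repeats coordinates up to sign
  and adds coordinates that vanish identically, so the closed sets are the same.\<close>

definition plucker :: "('m::finite \<Rightarrow> real ^ 'n ^ 'n) \<Rightarrow> ('m \<Rightarrow> 'n \<times> 'n) \<Rightarrow> real" where
  "plucker B I = det ((\<chi> k l. B k $ fst (I l) $ snd (I l)) :: real ^ 'm ^ 'm)"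

definition is_basis :: "('m::finite \<Rightarrow> real ^ 'n ^ 'n) \<Rightarrow> (real ^ 'n ^ 'n) set \<Rightarrow> bool" where
  "is_basis B L \<longleftrightarrow> inj B \<and> independent (range B) \<and> span (range B) = L"

text \<open>Multivariate polynomials with variables indexed by \<open>'x\<close>: finitely supported maps
  from monomials to coefficients, a monomial being a finitely supported exponent map.\<close>

type_synonym 'x real_mpoly = "('x \<Rightarrow>\<^sub>0 nat) \<Rightarrow>\<^sub>0 real"

definition eval_mpoly :: "'x real_mpoly \<Rightarrow> ('x \<Rightarrow> real) \<Rightarrow> real" where
  "eval_mpoly f x =
     (\<Sum>t\<in>Poly_Mapping.keys f. Poly_Mapping.lookup f t *
        (\<Prod>i\<in>Poly_Mapping.keys t. x i ^ Poly_Mapping.lookup t i))"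

definition homogeneous :: "'x real_mpoly \<Rightarrow> bool" where
  "homogeneous f \<longleftrightarrow>
     (\<exists>k. \<forall>t\<in>Poly_Mapping.keys f. (\<Sum>i\<in>Poly_Mapping.keys t. Poly_Mapping.lookup t i) = k)"

text \<open>Zariski-closed subsets of the Grassmannian of \<open>CARD('m)\<close>-dimensional subspaces: zero
  loci of sets of homogeneous polynomials in the Pluecker coordinates. Another basis of \<open>L\<close>
  multiplies the whole Pluecker vector by a nonzero scalar, so the quantification over all
  bases is the same as the choice of one.\<close>

definition zariski_closed :: "'m::finite itself \<Rightarrow> (real ^ 'n ^ 'n) set set \<Rightarrow> bool" where
  "zariski_closed TYPE('m) X \<longleftrightarrow>
     (\<exists>F :: ('m \<Rightarrow> 'n \<times> 'n) real_mpoly set.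
        (\<forall>f\<in>F. homogeneous f) \<and>
        X = {L \<in> grassmannian CARD('m).
               \<forall>f\<in>F. \<forall>B. is_basis B L \<longrightarrow> eval_mpoly f (plucker B) = 0})"

end

theory Submission
  imports Defs
begin

text \<open>
  Write \<open>r = n - d\<close>. The proof is a dimension count, carried out with explicit polynomials so that it
  ends in a Zariski-closed set rather than in a set of measure zero.

  \<^emph>\<open>Parametrization.\<close> A symmetric matrix of rank \<open>r\<close> has the form \<open>(1 + B) A (1 + B)\<^sup>T\<close>, where for
  some index set \<open>S\<close> of size \<open>r\<close> the matrix \<open>A\<close> is symmetric, invertible and supported on \<open>S \<times> S\<close>, and
  \<open>B\<close> is supported on \<open>(-S) \<times> S\<close> (\<open>sym_factorization\<close>). Such matrices depend polynomially on the
  coordinates \<open>\<xi>\<close> of \<open>A\<close> and \<open>B\<close>, without redundancy, and they stay positive semidefinite of rank \<open>r\<close>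
  under small changes of \<open>\<xi>\<close> once \<open>A\<close> is positive definite on \<open>S\<close> (\<open>positive_on_open\<close>). A general
  \<open>L\<close> is cut out of the symmetric matrices by solving for some entries in terms of \<open>m\<close> others; the
  coefficients \<open>a\<close> of these equations are quotients of Pluecker coordinates (\<open>chart_of_basis\<close>). So it
  is enough to find a nonzero polynomial in \<open>a\<close> that vanishes on all exceptional \<open>L\<close>
  (\<open>thin_in_chart_imp_zariski\<close>); sets with this property are called thin.

  \<^emph>\<open>Two ways to be exceptional.\<close> Let \<open>\<Omega> \<in> L\<close> be positive semidefinite of rank \<open>r\<close>, at parameter
  \<open>\<xi>\<close>. If the equations of \<open>L\<close>, as functions of the parameter, have dependent differentials at \<open>\<xi>\<close>,
  then there is a nonzero symmetric \<open>Y\<close> orthogonal to \<open>L\<close> with \<open>Y \<Omega> = 0\<close>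
  (\<open>critical_conormal\<close>). Otherwise the solutions near \<open>\<xi>\<close> surject onto an open box in some of the
  coordinates of \<open>\<xi>\<close>, as many as the dimension of the solution set
  (\<open>solutions_over_open_box\<close>), and each of these nearby \<open>\<Omega>\<close> is non-transversal: some nonzero
  symmetric \<open>Y\<close> is orthogonal to \<open>L\<close> and to all symmetric matrices whose columns lie in the column
  span of \<open>\<Omega>\<close> (\<open>non_transversal_conormal\<close>).

  \<^emph>\<open>Counting.\<close> Both conditions have the same shape: a matrix \<open>Y\<close> in a linear space that depends
  polynomially on \<open>B\<close> is orthogonal to \<open>L \<ni> \<Omega>\<close>. Given \<open>\<Omega>\<close> and \<open>Y\<close>, one row and one column of the
  coefficient matrix \<open>a\<close> are determined by the others, so the tuples \<open>(a, \<xi>)\<close> with such a \<open>Y\<close> are the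
  image of a rational map from an affine space (\<open>thin_has_conormal\<close>). In the first case, after scaling
  \<open>\<Omega>\<close> and \<open>Y\<close>, this space has one dimension less than the space of all \<open>a\<close>. In the second case, where
  \<open>a\<close> is taken together with the box coordinates, the dimension drops exactly when \<open>m\<close> is larger than
  the codimension \<open>dn - (d choose 2)\<close> of the space of symmetric matrices with columns in the column
  span of \<open>\<Omega>\<close>, which is the hypothesis on \<open>m\<close>. A rational map that raises the dimension has its image
  inside a hypersurface, by comparing numbers of monomials (\<open>thin_rational_image\<close>). In the second
  case the resulting polynomial vanishes on an open box of values of the box coordinates, hence for
  all values, and evaluating these coordinates at a suitable point leaves a nonzero polynomial in
  \<open>a\<close> (\<open>thin_slice\<close>).
\<close>

section \<open>Polynomial functions and thin sets\<close>

inductive polyn :: "'s set \<Rightarrow> (('s \<Rightarrow> real) \<Rightarrow> real) \<Rightarrow> bool" for S where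
  const: "polyn S (\<lambda>_. c)"
| var: "s \<in> S \<Longrightarrow> polyn S (\<lambda>x. x s)"
| add: "polyn S f \<Longrightarrow> polyn S g \<Longrightarrow> polyn S (\<lambda>x. f x + g x)"
| mult: "polyn S f \<Longrightarrow> polyn S g \<Longrightarrow> polyn S (\<lambda>x. f x * g x)"

lemma polyn_uminus: "polyn S f \<Longrightarrow> polyn S (\<lambda>x. - f x)"
  using polyn.mult[OF polyn.const[of S "-1"]] by simp

lemma polyn_diff: "polyn S f \<Longrightarrow> polyn S g \<Longrightarrow> polyn S (\<lambda>x. f x - g x)"
  using polyn.add[OF _ polyn_uminus] by simp

lemma polyn_sum: "(\<And>i. i \<in> I \<Longrightarrow> polyn S (f i)) \<Longrightarrow> polyn S (\<lambda>x. \<Sum>i\<in>I. f i x)"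
  by (induction I rule: infinite_finite_induct) (auto intro: polyn.intros)

lemma polyn_prod: "(\<And>i. i \<in> I \<Longrightarrow> polyn S (f i)) \<Longrightarrow> polyn S (\<lambda>x. \<Prod>i\<in>I. f i x)"
  by (induction I rule: infinite_finite_induct) (auto intro: polyn.intros)

lemma polyn_power: "polyn S f \<Longrightarrow> polyn S (\<lambda>x. f x ^ k)"
  by (induction k) (auto intro: polyn.intros)

lemma polyn_if: "(b \<Longrightarrow> polyn S f) \<Longrightarrow> (\<not> b \<Longrightarrow> polyn S g) \<Longrightarrow> polyn S (\<lambda>x. if b then f x else g x)"
  by (cases b) auto

text \<open>A polynomial function is controlled by its restrictions to lines, which are univariate polynomials
  with finitely many roots.\<close>
lemma polyn_restrict_line:
  assumes "polyn S f"
  shows "\<exists>p :: real poly. \<forall>s. f (\<lambda>v. x v + s * y v) = poly p s"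
  using assms
proof induction
  case (const c)
  show ?case by (rule exI[of _ "[:c:]"]) simp
next
  case (var v)
  show ?case by (rule exI[of _ "[:x v, y v:]"]) simp
next
  case (add f g)
  then obtain p q where "\<forall>s. f (\<lambda>v. x v + s * y v) = poly p s" "\<forall>s. g (\<lambda>v. x v + s * y v) = poly q s"
    by blast
  then show ?case by (intro exI[of _ "p + q"]) simp
next
  case (mult f g)
  then obtain p q where "\<forall>s. f (\<lambda>v. x v + s * y v) = poly p s" "\<forall>s. g (\<lambda>v. x v + s * y v) = poly q s"
    by blast
  then show ?case by (intro exI[of _ "p * q"]) simp
qed

definition thin :: "'s set \<Rightarrow> ('s \<Rightarrow> real) set \<Rightarrow> bool" where
  "thin S A \<longleftrightarrow> (\<exists>f. polyn S f \<and> (\<exists>x. f x \<noteq> 0) \<and> (\<forall>x\<in>A. f x = 0))"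

lemma thin_subset: "thin S B \<Longrightarrow> A \<subseteq> B \<Longrightarrow> thin S A"
  unfolding thin_def by blast

lemma thin_empty: "thin S {}"
  unfolding thin_def by (auto intro!: exI[of _ "\<lambda>_. 1"] polyn.const)

text \<open>On the line through a point where the first polynomial is nonzero and a point where the second is
  nonzero, both restrict to nonzero univariate polynomials, so their product is not identically zero.\<close>
lemma thin_Un:
  assumes "thin S A" "thin S B"
  shows "thin S (A \<union> B)"
proof -
  obtain f x where f: "polyn S f" "f x \<noteq> 0" "\<forall>x\<in>A. f x = 0"
    using assms unfolding thin_def by blast
  obtain g y where g: "polyn S g" "g y \<noteq> 0" "\<forall>x\<in>B. g x = 0"
    using assms unfolding thin_def by blast
  obtain p where p: "\<And>s. f (\<lambda>v. x v + s * (y v - x v)) = poly p s"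
    using polyn_restrict_line[OF f(1), of x "\<lambda>v. y v - x v"] by blast
  obtain q where q: "\<And>s. g (\<lambda>v. x v + s * (y v - x v)) = poly q s"
    using polyn_restrict_line[OF g(1), of x "\<lambda>v. y v - x v"] by blast
  have "p \<noteq> 0" using p[of 0] f(2) by auto
  moreover have "q \<noteq> 0" using q[of 1] g(2) by auto
  ultimately have "p * q \<noteq> 0" by simp
  then obtain s where "poly (p * q) s \<noteq> 0" using poly_all_0_iff_0 by blast
  then have "f (\<lambda>v. x v + s * (y v - x v)) * g (\<lambda>v. x v + s * (y v - x v)) \<noteq> 0"
    using p q by simp
  then show ?thesis
    unfolding thin_def using f g
    by (intro exI[of _ "\<lambda>x. f x * g x"]) (auto intro: polyn.mult)
qed

lemma thin_UN: "finite I \<Longrightarrow> (\<And>i. i \<in> I \<Longrightarrow> thin S (A i)) \<Longrightarrow> thin S (\<Union>i\<in>I. A i)"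
  by (induction I rule: finite_induct) (auto intro: thin_empty thin_Un)

text \<open>Every line through the centre of the box meets the box in infinitely many points.\<close>
lemma polyn_vanishing_near:
  assumes f: "polyn S f" and K: "finite K" "S \<subseteq> K"
    and e: "e > 0" and van: "\<And>x. (\<And>v. v \<in> K \<Longrightarrow> \<bar>x v - x0 v\<bar> < e) \<Longrightarrow> f x = 0"
  shows "f x = 0"
proof -
  obtain p where p: "\<And>s. f (\<lambda>v. x0 v + s * (x v - x0 v)) = poly p s"
    using polyn_restrict_line[OF f, of x0 "\<lambda>v. x v - x0 v"] by blast
  define M where "M = (\<Sum>v\<in>K. \<bar>x v - x0 v\<bar>) + 1"
  have M: "\<bar>x v - x0 v\<bar> < M" if "v \<in> K" for v
    unfolding M_def using member_le_sum[OF that, of "\<lambda>v. \<bar>x v - x0 v\<bar>"] K by auto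
  have M0: "M > 0" unfolding M_def by (simp add: add_nonneg_pos sum_nonneg)
  have "poly p s = 0" if s: "s \<in> {0<..<e/M}" for s
  proof -
    have "\<bar>s * (x v - x0 v)\<bar> < e" if "v \<in> K" for v
    proof -
      have "\<bar>s * (x v - x0 v)\<bar> = s * \<bar>x v - x0 v\<bar>" using s by (simp add: abs_mult)
      also have "\<dots> \<le> s * M" using M[OF that] s by (intro mult_left_mono) auto
      also have "\<dots> < e" using s M0 by (simp add: field_simps)
      finally show ?thesis .
    qed
    then have "f (\<lambda>v. x0 v + s * (x v - x0 v)) = 0" by (intro van) simp
    then show ?thesis by (simp add: p)
  qed
  then have "{0<..<e/M} \<subseteq> {s. poly p s = 0}" by blast
  moreover have "infinite {0<..<e/M}" using e M0 by (simp add: infinite_Ioo)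
  ultimately have "p = 0" using poly_roots_finite finite_subset by metis
  then show ?thesis using p[of 1] by simp
qed

lemma polyn_specialize:
  assumes "polyn S f" "\<And>s. s \<in> S \<Longrightarrow> polyn V (\<lambda>a. \<phi> a s)"
  shows "polyn V (\<lambda>a. f (\<phi> a))"
  using assms by induction (auto intro: polyn.intros)

text \<open>This turns a hypersurface in a product into one in the first factor. If \<open>f\<close> vanishes on \<open>Z\<close>
  and \<open>Z\<close> contains a whole box over \<open>a\<close>, then \<open>f a\<close> vanishes identically in the second argument. It
  therefore suffices to fix the second argument at a point \<open>t1\<close> for which \<open>f\<close> is still nonzero
  somewhere.\<close>
lemma thin_slice:
  fixes V :: "'a set" and K :: "'b set"
  assumes th: "thin (V <+> K) {case_sum a t | a t. (a, t) \<in> Z}" and K: "finite K"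
  shows "thin V {a. \<exists>t0 e. e > 0 \<and> (\<forall>t. (\<forall>c\<in>K. \<bar>t c - t0 c\<bar> < e) \<longrightarrow> (a, t) \<in> Z)}"
proof -
  obtain f z0 where f: "polyn (V <+> K) f" "f z0 \<noteq> 0" "\<And>a t. (a, t) \<in> Z \<Longrightarrow> f (case_sum a t) = 0"
    using th unfolding thin_def by blast
  define t1 where "t1 = z0 \<circ> Inr"
  define a1 where "a1 = z0 \<circ> Inl"
  have z0: "z0 = case_sum a1 t1" unfolding a1_def t1_def by (auto simp: fun_eq_iff split: sum.split)
  have p1: "polyn V (\<lambda>a. f (case_sum a t1))"
    by (rule polyn_specialize[OF f(1)]) (auto intro: polyn.intros)
  have p2: "polyn K (\<lambda>t. f (case_sum a t))" for a
    by (rule polyn_specialize[OF f(1)]) (auto intro: polyn.intros)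
  have "f (case_sum a t1) = 0"
    if "e > 0" "\<forall>t. (\<forall>c\<in>K. \<bar>t c - t0 c\<bar> < e) \<longrightarrow> (a, t) \<in> Z" for a t0 e
    by (rule polyn_vanishing_near[OF p2 K order_refl that(1), of t0]) (use that f(3) in blast)
  then show ?thesis unfolding thin_def
    using p1 f(2) z0 by (intro exI[of _ "\<lambda>a. f (case_sum a t1)"]) auto
qed

lemma polyn_cong:
  assumes "polyn S f" "\<And>v. v \<in> S \<Longrightarrow> z v = z' v"
  shows "f z = f z'"
  using assms by induction auto

lemma thin_project_Inl:
  assumes "thin (V <+> {}) {case_sum a t | a t. (a, t) \<in> Z}"
  shows "thin V (Domain Z)"
proof -
  obtain f z0 where f: "polyn (V <+> {}) f" "f z0 \<noteq> 0" "\<And>a t. (a, t) \<in> Z \<Longrightarrow> f (case_sum a t) = 0"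
    using assms unfolding thin_def by blast
  define u :: "'b \<Rightarrow> real" where "u = (\<lambda>_. 0)"
  have p1: "polyn V (\<lambda>a. f (case_sum a u))"
    by (rule polyn_specialize[OF f(1)]) (auto intro: polyn.var)
  have "f (case_sum (z0 \<circ> Inl) u) = f z0"
    by (rule polyn_cong[OF f(1)]) auto
  moreover have eq: "f (case_sum a u) = f (case_sum a t)" for a t
    by (rule polyn_cong[OF f(1)]) auto
  moreover have "\<forall>a\<in>Domain Z. f (case_sum a u) = 0"
  proof
    fix a assume "a \<in> Domain Z"
    then obtain t where "(a, t) \<in> Z" by blast
    then show "f (case_sum a u) = 0" using f(3) eq[of a t] by simp
  qed
  ultimately show ?thesis unfolding thin_def using p1 f(2)
    by (intro exI[of _ "\<lambda>a. f (case_sum a u)"] conjI exI[of _ "z0 \<circ> Inl"]) simp_all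
qed

section \<open>Images of rational maps that raise the dimension\<close>

definition monom_fun :: "'s set \<Rightarrow> ('s \<Rightarrow> nat) \<Rightarrow> ('s \<Rightarrow> real) \<Rightarrow> real" where
  "monom_fun S e x = (\<Prod>s\<in>S. x s ^ e s)"

text \<open>Polynomial functions with all exponents of single variables at most \<open>k\<close>. Bounding each exponent
  rather than the total degree makes the number of monomials a plain power.\<close>
inductive polyn_le :: "'s set \<Rightarrow> nat \<Rightarrow> (('s \<Rightarrow> real) \<Rightarrow> real) \<Rightarrow> bool" for S k where
  zero: "polyn_le S k (\<lambda>_. 0)"
| step: "polyn_le S k f \<Longrightarrow> (\<And>s. s \<in> S \<Longrightarrow> e s \<le> k) \<Longrightarrow> polyn_le S k (\<lambda>x. f x + c * monom_fun S e x)"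

lemma monom_fun_mult: "monom_fun S e x * monom_fun S e' x = monom_fun S (\<lambda>s. e s + e' s) x"
  by (simp add: monom_fun_def power_add prod.distrib)

lemma polyn_le_mono: "polyn_le S k f \<Longrightarrow> k \<le> l \<Longrightarrow> polyn_le S l f"
  by (induction rule: polyn_le.induct) (auto intro!: polyn_le.intros intro: order_trans)

lemma polyn_le_monom: "(\<And>s. s \<in> S \<Longrightarrow> e s \<le> k) \<Longrightarrow> polyn_le S k (\<lambda>x. c * monom_fun S e x)"
  using polyn_le.step[OF polyn_le.zero, of S e k c] by simp

lemma polyn_le_add: 
  assumes f: "polyn_le S k f" and g: "polyn_le S k g"
  shows "polyn_le S k (\<lambda>x. f x + g x)"
  using g
proof induction
  case (step g e c)
  from polyn_le.step[OF step.IH step.hyps(2), where c = c] show ?case by (simp add: add.assoc)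
qed (use f in simp)

lemma polyn_le_monom_mult:
  assumes f: "polyn_le S k f" and e: "\<And>s. s \<in> S \<Longrightarrow> e s \<le> l"
  shows "polyn_le S (k + l) (\<lambda>x. f x * (c * monom_fun S e x))"
  using f
proof induction
  case zero
  show ?case using polyn_le.zero by simp
next
  case (step f e' c')
  have "polyn_le S (k + l) (\<lambda>x. f x * (c * monom_fun S e x) + (c' * c) * monom_fun S (\<lambda>s. e' s + e s) x)"
    by (rule polyn_le.step[OF step.IH]) (use step.hyps(2) e in \<open>auto intro: add_mono\<close>)
  then show ?case by (simp add: algebra_simps flip: monom_fun_mult)
qed

lemma polyn_le_mult:
  assumes f: "polyn_le S k f" and g: "polyn_le S l g"
  shows "polyn_le S (k + l) (\<lambda>x. f x * g x)"
  using g
proof induction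
  case zero
  show ?case using polyn_le.zero by simp
next
  case (step g e c)
  have "polyn_le S (k + l) (\<lambda>x. f x * (c * monom_fun S e x))"
    by (rule polyn_le_monom_mult[OF f step.hyps(2)])
  from polyn_le_add[OF step.IH this] show ?case by (simp add: distrib_left)
qed

lemma polyn_le_const: "polyn_le S k (\<lambda>_. c)"
  using polyn_le_monom[of S "\<lambda>_. 0" k c] by (simp add: monom_fun_def)

lemma polyn_le_power: "polyn_le S k f \<Longrightarrow> polyn_le S (k * i) (\<lambda>x. f x ^ i)"
proof (induction i)
  case (Suc i)
  then show ?case using polyn_le_mult[of S k f "k * i"] by simp
qed (simp add: polyn_le_const)

lemma polyn_le_prod: 
  assumes "\<And>v. v \<in> V \<Longrightarrow> polyn_le S k (f v)"
  shows "polyn_le S (k * card V) (\<lambda>x. \<Prod>v\<in>V. f v x)"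
  using assms
proof (induction V rule: infinite_finite_induct)
  case (insert v V)
  then show ?case using polyn_le_mult[of S k "f v" "k * card V"] by simp
qed (simp_all add: polyn_le_const)

lemma polyn_imp_bounded:
  assumes "polyn S f" "finite S"
  shows "\<exists>k. polyn_le S k f"
  using assms
proof induction
  case (var s)
  have *: "monom_fun S (\<lambda>t. if t = s then 1 else 0) x = x s" for x
  proof -
    have "monom_fun S (\<lambda>t. if t = s then 1 else 0) x = (\<Prod>t\<in>S. if t = s then x t else 1)"
      unfolding monom_fun_def by (rule prod.cong) auto
    then show ?thesis using var by (simp add: prod.delta)
  qed
  have "polyn_le S 1 (\<lambda>x. 1 * monom_fun S (\<lambda>t. if t = s then 1 else 0) x)"
    by (rule polyn_le_monom) auto
  then show ?case using * by auto
next
  case (add f g)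
  then obtain k l where "polyn_le S k f" "polyn_le S l g" by blast
  then have "polyn_le S (max k l) f" "polyn_le S (max k l) g" by (auto intro: polyn_le_mono)
  then show ?case by (blast intro: polyn_le_add)
qed (use polyn_le_const polyn_le_mult in blast)+

lemma polyn_le_coefficients:
  assumes "polyn_le S k f" "finite S"
  shows "\<exists>c. \<forall>x. f x = (\<Sum>e\<in>S \<rightarrow>\<^sub>E {..k}. c e * monom_fun S e x)"
  using assms(1)
proof induction
  case zero
  show ?case by (intro exI[of _ "\<lambda>_. 0"]) simp
next
  case (step f e c)
  then obtain d where d: "\<And>x. f x = (\<Sum>e\<in>S \<rightarrow>\<^sub>E {..k}. d e * monom_fun S e x)" by blast
  define e' where "e' = restrict e S"
  have e': "e' \<in> S \<rightarrow>\<^sub>E {..k}" using step.hyps(2) unfolding e'_def by auto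
  have fin: "finite (S \<rightarrow>\<^sub>E {..k})" using assms(2) by (simp add: finite_PiE)
  have m: "monom_fun S e' x = monom_fun S e x" for x
    unfolding monom_fun_def e'_def by (rule prod.cong) auto
  have "f x + c * monom_fun S e x
      = (\<Sum>e\<in>S \<rightarrow>\<^sub>E {..k}. (d e + (if e = e' then c else 0)) * monom_fun S e x)" for x
  proof -
    have "(\<Sum>e\<in>S \<rightarrow>\<^sub>E {..k}. (if e = e' then c else 0) * monom_fun S e x) =
       (\<Sum>e\<in>S \<rightarrow>\<^sub>E {..k}. if e = e' then c * monom_fun S e x else 0)"
      by (rule sum.cong) auto
    also have "\<dots> = c * monom_fun S e' x" using e' fin by (simp add: sum.delta)
    finally show ?thesis by (simp add: d distrib_right sum.distrib m)
  qed
  then show ?case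
    by (intro exI[of _ "\<lambda>e. d e + (if e = e' then c else 0)"]) blast
qed

text \<open>Gaussian elimination of one equation at a time.\<close>
lemma underdetermined_system:
  fixes M :: "'a \<Rightarrow> 'b \<Rightarrow> real"
  assumes "finite B" "finite A" "card B < card A"
  shows "\<exists>c. (\<exists>a\<in>A. c a \<noteq> 0) \<and> (\<forall>b\<in>B. (\<Sum>a\<in>A. c a * M a b) = 0)"
  using assms
proof (induction B arbitrary: A M rule: finite_induct)
  case empty
  then obtain a where "a \<in> A" by fastforce
  then show ?case by (intro exI[of _ "\<lambda>_. 1"]) auto
next
  case (insert b B)
  show ?case
  proof (cases "\<forall>a\<in>A. M a b = 0")
    case True
    have "card B < card A" using insert by simp
    then obtain c where "\<exists>a\<in>A. c a \<noteq> 0" "\<forall>b\<in>B. (\<Sum>a\<in>A. c a * M a b) = 0"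
      using insert.IH[OF insert.prems(1), of M] by blast
    with True show ?thesis by (intro exI[of _ c]) auto
  next
    case False
    then obtain a0 where a0: "a0 \<in> A" "M a0 b \<noteq> 0" by blast
    define A' where "A' = A - {a0}"
    have A': "finite A'" "A = insert a0 A'" "a0 \<notin> A'" using insert a0 by (auto simp: A'_def)
    define M' where "M' = (\<lambda>a b'. M a b' - M a b / M a0 b * M a0 b')"
    have "card B < card A'" using insert A' by simp
    then obtain c where c: "\<exists>a\<in>A'. c a \<noteq> 0" "\<forall>b\<in>B. (\<Sum>a\<in>A'. c a * M' a b) = 0"
      using insert.IH[OF A'(1), of M'] by blast
    define c' where "c' = c(a0 := - (\<Sum>a\<in>A'. c a * M a b) / M a0 b)"
    have eq: "(\<Sum>a\<in>A. c' a * M a b') = (\<Sum>a\<in>A'. c a * M' a b')" for b'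
    proof -
      have "(\<Sum>a\<in>A. c' a * M a b') = c' a0 * M a0 b' + (\<Sum>a\<in>A'. c' a * M a b')"
        using A' by simp
      also have "(\<Sum>a\<in>A'. c' a * M a b') = (\<Sum>a\<in>A'. c a * M a b')"
        by (rule sum.cong) (use A' in \<open>auto simp: c'_def\<close>)
      also have "c' a0 * M a0 b' = - (\<Sum>a\<in>A'. c a * (M a b / M a0 b * M a0 b'))"
        unfolding c'_def by (simp add: sum_distrib_right sum_divide_distrib mult.assoc)
      finally show ?thesis unfolding M'_def
        by (simp add: right_diff_distrib sum_subtractf)
    qed
    have "(\<Sum>a\<in>A. c' a * M a b') = 0" if "b' \<in> insert b B" for b'
      using that c(2) a0(2) unfolding eq by (auto simp: M'_def)
    moreover have "\<exists>a\<in>A. c' a \<noteq> 0" using c(1) A' unfolding c'_def by force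
    ultimately show ?thesis by blast
  qed
qed

text \<open>Induction on the variables: for fixed values of the others, the sum is a univariate polynomial in
  the new variable, and its coefficients are sums of the same kind.\<close>
lemma monomials_independent:
  assumes "finite V" "\<And>z. (\<Sum>e\<in>V \<rightarrow>\<^sub>E {..<D}. c e * monom_fun V e z) = 0" "e \<in> V \<rightarrow>\<^sub>E {..<D}"
  shows "c e = 0"
  using assms
proof (induction V arbitrary: c e rule: finite_induct)
  case empty
  then show ?case by (simp add: monom_fun_def)
next
  case (insert v V)
  define P where "P = (\<lambda>z. \<Sum>i<D. monom (\<Sum>e\<in>V \<rightarrow>\<^sub>E {..<D}. c (e(v := i)) * monom_fun V e z) i)"
  have inj: "inj_on (\<lambda>(i, e). e(v := i)) ({..<D} \<times> (V \<rightarrow>\<^sub>E {..<D}))"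
    using inj_combinator[of v V "\<lambda>_. {..<D}"] insert.hyps(2) by simp
  have "poly (P z) s = 0" for z s
  proof -
    have "0 = (\<Sum>e\<in>insert v V \<rightarrow>\<^sub>E {..<D}. c e * monom_fun (insert v V) e (z(v := s)))"
      using insert.prems(1) by simp
    also have "\<dots> = (\<Sum>(i,e)\<in>{..<D} \<times> (V \<rightarrow>\<^sub>E {..<D}).
        c (e(v := i)) * monom_fun (insert v V) (e(v := i)) (z(v := s)))"
      unfolding PiE_insert_eq sum.reindex[OF inj] by (simp add: case_prod_unfold)
    also have "\<dots> = (\<Sum>(i,e)\<in>{..<D} \<times> (V \<rightarrow>\<^sub>E {..<D}). c (e(v := i)) * monom_fun V e z * s ^ i)"
    proof -
      have "monom_fun (insert v V) (e(v := i)) (z(v := s)) = monom_fun V e z * s ^ i" for i e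
      proof -
        have "(\<Prod>t\<in>V. (z(v := s)) t ^ (e(v := i)) t) = (\<Prod>t\<in>V. z t ^ e t)"
          by (rule prod.cong) (use insert.hyps(2) in auto)
        then show ?thesis unfolding monom_fun_def using insert.hyps by simp
      qed
      then show ?thesis by (simp add: mult.assoc)
    qed
    also have "\<dots> = poly (P z) s"
      unfolding P_def by (simp add: poly_sum poly_monom sum_distrib_right sum.cartesian_product)
    finally show ?thesis by simp
  qed
  then have P0: "P z = 0" for z using poly_all_0_iff_0 by blast
  have zero: "(\<Sum>e\<in>V \<rightarrow>\<^sub>E {..<D}. c (e(v := i)) * monom_fun V e z) = 0" if "i < D" for i z
  proof -
    have "coeff (P z) i = (\<Sum>e\<in>V \<rightarrow>\<^sub>E {..<D}. c (e(v := i)) * monom_fun V e z)"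
      unfolding P_def using that by (simp add: coeff_sum)
    then show ?thesis using P0 by simp
  qed
  obtain i e' where e: "e = e'(v := i)" "i < D" "e' \<in> V \<rightarrow>\<^sub>E {..<D}"
    using insert.prems(2) unfolding PiE_insert_eq by auto
  have "c (e'(v := i)) = 0"
    using insert.IH[of "\<lambda>e. c (e(v := i))" e', OF zero[OF e(2)] e(3)] .
  then show ?case unfolding e(1) .
qed

text \<open>With \<open>q = card V\<close>, there are \<open>D ^ q\<close> monomials with exponents below \<open>D\<close> in the coordinates of the
  target. Composed with \<open>\<phi>\<close> and multiplied by a power of the common denominator \<open>h\<close>, each becomes a
  polynomial with exponents at most \<open>q * k * D\<close> in the coordinates of the source. There are at most
  \<open>(C * D) ^ card S\<close> monomials of this size, which is less than \<open>D ^ q\<close> for large \<open>D\<close>. So some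
  nontrivial combination of the target monomials vanishes on the image.\<close>
lemma thin_rational_image:
  assumes S: "finite S" and V: "finite V" and card: "card S < card V"
    and num: "\<And>v. v \<in> V \<Longrightarrow> polyn S (num v)" and h: "polyn S h"
    and \<phi>: "\<And>x v. v \<in> V \<Longrightarrow> h x \<noteq> 0 \<Longrightarrow> h x * \<phi> x v = num v x"
  shows "thin V {\<phi> x | x. h x \<noteq> 0}"
proof -
  define q where "q = card V"
  obtain kn where kn: "\<And>v. v \<in> V \<Longrightarrow> polyn_le S (kn v) (num v)"
    using polyn_imp_bounded[OF num S] by metis
  obtain kh where kh: "polyn_le S kh h" using polyn_imp_bounded[OF h S] by blast
  define k where "k = kh + (\<Sum>v\<in>V. kn v)"
  have num': "polyn_le S k (num v)" if "v \<in> V" for v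
    using polyn_le_mono[OF kn[OF that], of k] member_le_sum[OF that, of kn] V unfolding k_def by simp
  have h': "polyn_le S k h" using polyn_le_mono[OF kh, of k] unfolding k_def by simp
  \<comment> \<open>\<open>D = C ^ card S + 1\<close> is chosen to make \<open>(D * C) ^ card S < D ^ Suc (card S)\<close>.\<close>
  define C where "C = q * k + 1"
  define D where "D = C ^ card S + 1"
  \<comment> \<open>the monomial with exponents \<open>e\<close> in the values \<open>\<phi> x\<close>, multiplied by \<open>h x ^ (D * q)\<close>\<close>
  define Q where "Q = (\<lambda>e x. \<Prod>v\<in>V. num v x ^ e v * h x ^ (D - e v))"
  have Q: "polyn_le S (k * D * q) (Q e)" if e: "e \<in> V \<rightarrow>\<^sub>E {..<D}" for e
    unfolding Q_def q_def
  proof (rule polyn_le_prod)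
    fix v assume v: "v \<in> V"
    then have "e v < D" using e by auto
    then have "k * e v + k * (D - e v) = k * D"
      by (metis add_mult_distrib2 le_add_diff_inverse less_imp_le)
    then show "polyn_le S (k * D) (\<lambda>x. num v x ^ e v * h x ^ (D - e v))"
      using polyn_le_mult[OF polyn_le_power[OF num'[OF v]] polyn_le_power[OF h'], of "e v" "D - e v"] by simp
  qed
  have "\<forall>e\<in>V \<rightarrow>\<^sub>E {..<D}. \<exists>c. \<forall>x. Q e x = (\<Sum>e'\<in>S \<rightarrow>\<^sub>E {..k * D * q}. c e' * monom_fun S e' x)"
    using polyn_le_coefficients[OF Q S] by blast
  from bchoice[OF this] obtain M where M: "\<And>e x. e \<in> V \<rightarrow>\<^sub>E {..<D} \<Longrightarrow>
      Q e x = (\<Sum>e'\<in>S \<rightarrow>\<^sub>E {..k * D * q}. M e e' * monom_fun S e' x)"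
    by blast
  have finE: "finite (S \<rightarrow>\<^sub>E {..k * D * q})" "finite (V \<rightarrow>\<^sub>E {..<D})"
    using S V by (simp_all add: finite_PiE)
  have "card (S \<rightarrow>\<^sub>E {..k * D * q}) = (k * D * q + 1) ^ card S"
    using S by (simp add: card_PiE)
  also have "\<dots> \<le> (D * C) ^ card S"
    by (rule power_mono) (simp_all add: C_def D_def algebra_simps)
  also have "\<dots> = D ^ card S * C ^ card S" by (rule power_mult_distrib)
  also have "\<dots> < D ^ card S * D" unfolding D_def by simp
  also have "\<dots> = D ^ Suc (card S)" by simp
  also have "\<dots> \<le> D ^ q" unfolding q_def by (rule power_increasing) (use card in \<open>auto simp: D_def\<close>)
  also have "\<dots> = card (V \<rightarrow>\<^sub>E {..<D})" using V by (simp add: card_PiE q_def)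
  finally obtain c where c: "\<exists>e\<in>V \<rightarrow>\<^sub>E {..<D}. c e \<noteq> 0"
      "\<forall>e'\<in>S \<rightarrow>\<^sub>E {..k * D * q}. (\<Sum>e\<in>V \<rightarrow>\<^sub>E {..<D}. c e * M e e') = 0"
    using underdetermined_system[OF finE, of M] by blast
  have cQ: "(\<Sum>e\<in>V \<rightarrow>\<^sub>E {..<D}. c e * Q e x) = 0" for x
  proof -
    have "(\<Sum>e\<in>V \<rightarrow>\<^sub>E {..<D}. c e * Q e x) =
      (\<Sum>e\<in>V \<rightarrow>\<^sub>E {..<D}. \<Sum>e'\<in>S \<rightarrow>\<^sub>E {..k * D * q}. c e * M e e' * monom_fun S e' x)"
      by (rule sum.cong) (simp_all add: M sum_distrib_left mult.assoc)
    also have "\<dots> = (\<Sum>e'\<in>S \<rightarrow>\<^sub>E {..k * D * q}. (\<Sum>e\<in>V \<rightarrow>\<^sub>E {..<D}. c e * M e e') * monom_fun S e' x)"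
      by (subst sum.swap) (simp add: sum_distrib_right)
    also have "\<dots> = 0" using c(2) by simp
    finally show ?thesis .
  qed
  define F where "F = (\<lambda>z. \<Sum>e\<in>V \<rightarrow>\<^sub>E {..<D}. c e * monom_fun V e z)"
  have "polyn V F" unfolding F_def monom_fun_def
    by (intro polyn_sum polyn.mult polyn.const polyn_prod polyn_power polyn.var)
  moreover have "\<exists>z. F z \<noteq> 0"
    using monomials_independent[OF V, of c D] c(1) unfolding F_def by blast
  moreover have "F (\<phi> x) = 0" if hx: "h x \<noteq> 0" for x
  proof -
    have "Q e x = h x ^ (D * q) * monom_fun V e (\<phi> x)" if e: "e \<in> V \<rightarrow>\<^sub>E {..<D}" for e
    proof -
      have "Q e x = (\<Prod>v\<in>V. h x ^ D * \<phi> x v ^ e v)" unfolding Q_def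
      proof (rule prod.cong)
        fix v assume v: "v \<in> V"
        then have ev: "e v < D" using e by auto
        have "num v x ^ e v * h x ^ (D - e v) = \<phi> x v ^ e v * (h x ^ e v * h x ^ (D - e v))"
          unfolding \<phi>[OF v hx, symmetric] by (simp add: power_mult_distrib)
        also have "h x ^ e v * h x ^ (D - e v) = h x ^ D"
          using ev by (simp flip: power_add)
        finally show "num v x ^ e v * h x ^ (D - e v) = h x ^ D * \<phi> x v ^ e v" by simp
      qed simp
      then show ?thesis
        unfolding monom_fun_def q_def by (simp add: prod.distrib power_mult)
    qed
    then have "h x ^ (D * q) * F (\<phi> x) = (\<Sum>e\<in>V \<rightarrow>\<^sub>E {..<D}. c e * Q e x)"
      unfolding F_def by (simp add: sum_distrib_left mult_ac)
    then show ?thesis using cQ hx by simp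
  qed
  ultimately show ?thesis unfolding thin_def by blast
qed

section \<open>Homogeneous polynomials in Pluecker coordinates\<close>

lemma mono_eval_superset:
  assumes "finite K" "Poly_Mapping.keys t \<subseteq> K"
  shows "(\<Prod>i\<in>Poly_Mapping.keys t. x i ^ Poly_Mapping.lookup t i) = (\<Prod>i\<in>K. (x i :: real) ^ Poly_Mapping.lookup t i)"
  by (rule prod.mono_neutral_left) (use assms in \<open>auto simp: in_keys_iff\<close>)

lemma mono_deg_superset:
  assumes "finite K" "Poly_Mapping.keys t \<subseteq> K"
  shows "(\<Sum>i\<in>Poly_Mapping.keys t. Poly_Mapping.lookup t i) = (\<Sum>i\<in>K. Poly_Mapping.lookup t i :: nat)"
  by (rule sum.mono_neutral_left) (use assms in \<open>auto simp: in_keys_iff\<close>)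

lemma eval_mpoly_superset:
  assumes "finite K" "Poly_Mapping.keys f \<subseteq> K"
  shows "eval_mpoly f x = (\<Sum>t\<in>K. Poly_Mapping.lookup f t * (\<Prod>i\<in>Poly_Mapping.keys t. x i ^ Poly_Mapping.lookup t i))"
  unfolding eval_mpoly_def
  by (rule sum.mono_neutral_left) (use assms in \<open>auto simp: in_keys_iff\<close>)

lemma eval_mpoly_add: "eval_mpoly (f + g) x = eval_mpoly f x + eval_mpoly g x"
proof -
  let ?K = "Poly_Mapping.keys f \<union> Poly_Mapping.keys g"
  have "finite ?K" "Poly_Mapping.keys f \<subseteq> ?K" "Poly_Mapping.keys g \<subseteq> ?K"
      "Poly_Mapping.keys (f + g) \<subseteq> ?K"
    by (auto simp: Poly_Mapping.keys_add)
  then show ?thesis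
    by (simp add: eval_mpoly_superset[of ?K] lookup_add distrib_right sum.distrib)
qed

lemma eval_mpoly_single:
  "eval_mpoly (Poly_Mapping.single t c) x = c * (\<Prod>i\<in>Poly_Mapping.keys t. x i ^ Poly_Mapping.lookup t i)"
  unfolding eval_mpoly_def by simp

lemma monomial_exists:
  assumes "finite V"
  shows "\<exists>t. (\<Sum>i\<in>Poly_Mapping.keys t. Poly_Mapping.lookup t i) = (\<Sum>v\<in>V. e v) \<and>
    (\<forall>x :: 'x \<Rightarrow> real. (\<Prod>i\<in>Poly_Mapping.keys t. x i ^ Poly_Mapping.lookup t i) = (\<Prod>v\<in>V. x (g v) ^ e v))"
  using assms
proof (induction V rule: finite_induct)
  case empty
  show ?case by (intro exI[of _ 0]) simp
next
  case (insert v V)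
  then obtain t where t: "(\<Sum>i\<in>Poly_Mapping.keys t. Poly_Mapping.lookup t i) = (\<Sum>v\<in>V. e v)"
    "\<And>x :: 'x \<Rightarrow> real. (\<Prod>i\<in>Poly_Mapping.keys t. x i ^ Poly_Mapping.lookup t i) = (\<Prod>v\<in>V. x (g v) ^ e v)"
    by blast
  define u where "u = t + Poly_Mapping.single (g v) (e v)"
  let ?K = "Poly_Mapping.keys t \<union> {g v}"
  have K: "finite ?K" "Poly_Mapping.keys t \<subseteq> ?K" "Poly_Mapping.keys u \<subseteq> ?K"
    using Poly_Mapping.keys_add[of t "Poly_Mapping.single (g v) (e v)"] unfolding u_def by (auto split: if_splits)
  have l: "Poly_Mapping.lookup u i = Poly_Mapping.lookup t i + (if i = g v then e v else 0)" for i
    unfolding u_def by (simp add: lookup_add lookup_single when_def)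
  have "(\<Sum>i\<in>?K. Poly_Mapping.lookup u i) = (\<Sum>i\<in>?K. Poly_Mapping.lookup t i) + (\<Sum>i\<in>?K. if i = g v then e v else 0)"
    by (subst sum.distrib[symmetric], rule sum.cong) (auto simp: l)
  also have "(\<Sum>i\<in>?K. if i = g v then e v else 0) = e v"
    using K(1) by (subst sum.delta) auto
  finally have 1: "(\<Sum>i\<in>Poly_Mapping.keys u. Poly_Mapping.lookup u i) = (\<Sum>v\<in>insert v V. e v)"
    using insert.hyps t(1) unfolding mono_deg_superset[OF K(1,3)] mono_deg_superset[OF K(1,2)]
    by simp
  have "(\<Prod>i\<in>Poly_Mapping.keys u. x i ^ Poly_Mapping.lookup u i) = (\<Prod>v\<in>insert v V. x (g v) ^ e v)" for x :: "'x \<Rightarrow> real"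
  proof -
    have "(\<Prod>i\<in>?K. x i ^ Poly_Mapping.lookup u i) = (\<Prod>i\<in>?K. x i ^ Poly_Mapping.lookup t i) * (\<Prod>i\<in>?K. x i ^ (if i = g v then e v else 0))"
      by (subst prod.distrib[symmetric], rule prod.cong) (auto simp: l power_add)
    also have "(\<Prod>i\<in>?K. x i ^ (if i = g v then e v else 0)) = (\<Prod>i\<in>?K. if i = g v then x i ^ e v else 1)"
      by (rule prod.cong) auto
    also have "\<dots> = x (g v) ^ e v" using K(1) by (subst prod.delta) auto
    finally show ?thesis using insert.hyps t(2)[of x]
      unfolding mono_eval_superset[OF K(1,3)] mono_eval_superset[OF K(1,2)]
      by simp
  qed
  with 1 show ?case by blast
qed

text \<open>Monomials are homogenized with powers of the variable \<open>x0\<close>. The degree exceeds the bound on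
  the degrees of the monomials, so that \<open>x0\<close> divides the result and its zero locus contains the hyperplane \<open>x0 = 0\<close>, that is,
  the complement of the chart.\<close>
lemma homogenize:
  fixes g :: "'v \<Rightarrow> 'x" and x0 :: 'x
  assumes G: "polyn V G" and V: "finite V"
  shows "\<exists>f N. homogeneous f \<and> (\<forall>x. eval_mpoly f x =
    (if x x0 = 0 then 0 else x x0 ^ N * G (\<lambda>v. x (g v) / x x0)))"
proof -
  obtain k where k: "polyn_le V k G" using polyn_imp_bounded[OF G V] by blast
  define N where "N = k * card V + 1"
  have "\<exists>f. (\<forall>t\<in>Poly_Mapping.keys f. (\<Sum>i\<in>Poly_Mapping.keys t. Poly_Mapping.lookup t i) = N)
      \<and> (\<forall>x. eval_mpoly f x = (if x x0 = 0 then 0 else x x0 ^ N * G (\<lambda>v. x (g v) / x x0)))"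
    using k
  proof induction
    case zero
    show ?case by (intro exI[of _ 0]) (simp add: eval_mpoly_def)
  next
    case (step G e c)
    then obtain f where f: "\<And>t. t \<in> Poly_Mapping.keys f \<Longrightarrow> (\<Sum>i\<in>Poly_Mapping.keys t. Poly_Mapping.lookup t i) = N"
      "\<And>x. eval_mpoly f x = (if x x0 = 0 then 0 else x x0 ^ N * G (\<lambda>v. x (g v) / x x0))"
      by blast
    have le: "(\<Sum>v\<in>V. e v) \<le> k * card V"
      using sum_bounded_above[of V e k] step.hyps(2) by (simp add: mult.commute)
    define r where "r = N - (\<Sum>v\<in>V. e v)"
    have r: "r > 0" "r + (\<Sum>v\<in>V. e v) = N" using le unfolding r_def N_def by auto
    define e' where "e' = case_option r e"
    define g' where "g' = case_option x0 g"
    have ins: "(\<Sum>v\<in>insert None (Some ` V). e' v) = N"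
      "(\<Prod>v\<in>insert None (Some ` V). x (g' v) ^ e' v) = x x0 ^ r * (\<Prod>v\<in>V. x (g v) ^ e v)" for x :: "'x \<Rightarrow> real"
      using V r(2) by (simp_all add: e'_def g'_def sum.reindex prod.reindex)
    obtain t where t: "(\<Sum>i\<in>Poly_Mapping.keys t. Poly_Mapping.lookup t i) = N"
      "\<And>x :: 'x \<Rightarrow> real. (\<Prod>i\<in>Poly_Mapping.keys t. x i ^ Poly_Mapping.lookup t i) = x x0 ^ r * (\<Prod>v\<in>V. x (g v) ^ e v)"
      using monomial_exists[of "insert None (Some ` V)" e' g'] V unfolding ins by auto
    have hom: "(\<Sum>i\<in>Poly_Mapping.keys u. Poly_Mapping.lookup u i) = N" if "u \<in> Poly_Mapping.keys (f + Poly_Mapping.single t c)" for u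
      using that f(1) t(1) Poly_Mapping.keys_add[of f "Poly_Mapping.single t c"] by (auto split: if_splits)
    have "eval_mpoly (f + Poly_Mapping.single t c) x =
      (if x x0 = 0 then 0 else x x0 ^ N * (G (\<lambda>v. x (g v) / x x0) + c * monom_fun V e (\<lambda>v. x (g v) / x x0)))" for x
    proof (cases "x x0 = 0")
      case True
      then show ?thesis using r by (simp add: eval_mpoly_add eval_mpoly_single f(2) t(2))
    next
      case False
      have "x x0 ^ N * monom_fun V e (\<lambda>v. x (g v) / x x0) = x x0 ^ r * (x x0 ^ (\<Sum>v\<in>V. e v) * monom_fun V e (\<lambda>v. x (g v) / x x0))"
        by (simp add: r(2)[symmetric] power_add)
      also have "x x0 ^ (\<Sum>v\<in>V. e v) * monom_fun V e (\<lambda>v. x (g v) / x x0) = (\<Prod>v\<in>V. x (g v) ^ e v)"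
        unfolding monom_fun_def power_sum prod.distrib[symmetric]
        by (rule prod.cong) (use False in \<open>auto simp: power_divide\<close>)
      finally show ?thesis using False by (simp add: eval_mpoly_add eval_mpoly_single f(2) t(2) distrib_left mult_ac)
    qed
    with hom show ?case by blast
  qed
  then show ?thesis unfolding homogeneous_def by blast
qed

section \<open>An affine chart of the Grassmannian\<close>

definition entry :: "real ^ 'n ^ 'n \<Rightarrow> 'n \<times> 'n \<Rightarrow> real" where
  "entry x p = x $ fst p $ snd p"

text \<open>Representatives of the matrix positions up to transposition: the positions on or above the diagonal
  with respect to an arbitrary enumeration of the index type.\<close>
definition upper :: "('n::finite \<times> 'n) set" where
  "upper = {(i, j). to_nat i \<le> to_nat j}"

definition fold_up :: "('n::finite \<times> 'n) \<Rightarrow> 'n \<times> 'n" where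
  "fold_up p = (if p \<in> upper then p else (snd p, fst p))"

lemma fold_up_upper: "fold_up p \<in> upper"
  unfolding fold_up_def upper_def by auto

lemma fold_up_id: "p \<in> upper \<Longrightarrow> fold_up p = p"
  unfolding fold_up_def by simp

lemma fold_up_swap: "fold_up (j, i) = fold_up (i, j)"
  unfolding fold_up_def upper_def by auto

lemma fold_up_cases: "fold_up (i, j) = (i, j) \<or> fold_up (i, j) = (j, i)"
  unfolding fold_up_def by auto

lemma sym_mats_entry: "x \<in> sym_mats \<longleftrightarrow> (\<forall>i j. x $ i $ j = x $ j $ i)"
  unfolding sym_mats_def by (auto simp: transpose_def vec_eq_iff)

lemma entry_fold_up: "x \<in> sym_mats \<Longrightarrow> entry x (fold_up p) = entry x p"
  unfolding fold_up_def entry_def sym_mats_entry by auto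

lemma sym_mats_eqI:
  assumes "x \<in> sym_mats" "y \<in> sym_mats" "\<And>p. p \<in> upper \<Longrightarrow> entry x p = entry y p"
  shows "x = y"
proof -
  have "entry x (i, j) = entry y (i, j)" for i j
    using assms fold_up_upper entry_fold_up by metis
  then show ?thesis by (simp add: vec_eq_iff entry_def)
qed

definition sym_of :: "('n::finite \<times> 'n \<Rightarrow> real) \<Rightarrow> real ^ 'n ^ 'n" where
  "sym_of \<xi> = (\<chi> i j. \<xi> (fold_up (i, j)))"

lemma sym_of_sym: "sym_of \<xi> \<in> sym_mats"
  unfolding sym_mats_entry sym_of_def by (simp add: fold_up_swap)

lemma entry_sym_of: "p \<in> upper \<Longrightarrow> entry (sym_of \<xi>) p = \<xi> p"
  unfolding sym_of_def entry_def by (simp add: fold_up_id)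

lemma subspace_sym_mats: "subspace sym_mats"
  unfolding subspace_def by (auto simp: sym_mats_entry)

lemma entry_add: "entry (x + y) p = entry x p + entry y p"
  unfolding entry_def by simp

lemma entry_scaleR: "entry (c *\<^sub>R x) p = c * entry x p"
  unfolding entry_def by simp

lemma entry_0: "entry 0 p = 0"
  unfolding entry_def by simp

lemma entry_sum: "entry (sum f A) p = (\<Sum>i\<in>A. entry (f i) p)"
  unfolding entry_def by simp

lemmas entry_simps = entry_add entry_scaleR entry_0 entry_sum

text \<open>The graph chart: the entries at the positions in the range of \<open>I\<close> are free, and the remaining ones
  are linear in them, with coefficients \<open>a\<close>.\<close>
definition chart_space :: "('m::finite \<Rightarrow> 'n::finite \<times> 'n) \<Rightarrow> (('n \<times> 'n) \<times> 'm \<Rightarrow> real) \<Rightarrow> (real ^ 'n ^ 'n) set" where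
  "chart_space I a = {x \<in> sym_mats. \<forall>j\<in>upper - range I. entry x j = (\<Sum>l\<in>UNIV. a (j, l) * entry x (I l))}"

lemma subspace_chart_space: "subspace (chart_space I a)"
proof -
  have "(\<Sum>l\<in>UNIV. a (j, l) * (entry x (I l) + entry y (I l))) = (\<Sum>l\<in>UNIV. a (j, l) * entry x (I l)) + (\<Sum>l\<in>UNIV. a (j, l) * entry y (I l))" for x y j
    by (simp add: distrib_left sum.distrib)
  moreover have "(\<Sum>l\<in>UNIV. a (j, l) * (c * entry x (I l))) = c * (\<Sum>l\<in>UNIV. a (j, l) * entry x (I l))" for x j and c :: real
    by (simp add: sum_distrib_left mult_ac)
  ultimately show ?thesis
    using subspace_sym_mats unfolding subspace_def chart_space_def by (simp add: entry_simps) blast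
qed

lemma chart_space_eqI:
  fixes x y :: "real ^ 'n::finite ^ 'n"
  assumes "x \<in> chart_space I a" "y \<in> chart_space I a" "\<And>l. entry x (I l) = entry y (I l)"
  shows "x = y"
proof (rule sym_mats_eqI)
  fix p :: "'n \<times> 'n"
  assume "p \<in> upper"
  then show "entry x p = entry y p"
    using assms unfolding chart_space_def by (cases "p \<in> range I") auto
qed (use assms in \<open>auto simp: chart_space_def\<close>)

text \<open>Cramer's rule. Replacing one of the columns \<open>I l\<close> of the coordinate matrix by the column \<open>j\<close>
  amounts to solving for the entry at \<open>j\<close> in terms of the entries at the positions \<open>I l\<close>.\<close>
lemma chart_of_basis:
  fixes B :: "'m::finite \<Rightarrow> real ^ 'n::finite ^ 'n"
  assumes B: "is_basis B L" and L: "L \<subseteq> sym_mats" and p: "plucker B I \<noteq> 0"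
  shows "L = chart_space I (\<lambda>(j, l). plucker B (I(l := j)) / plucker B I)" (is "L = ?C")
proof -
  define R :: "real ^ 'm ^ 'm" where "R = (\<chi> k l. entry (B k) (I l))"
  have R: "det R = plucker B I" unfolding R_def plucker_def entry_def ..
  have span: "span (range B) = L" using B unfolding is_basis_def by simp
  have BL: "B k \<in> L" for k unfolding span[symmetric] by (intro span_base rangeI)
  have "B k \<in> ?C" for k
  proof -
    have "entry (B k) j = (\<Sum>l\<in>UNIV. plucker B (I(l := j)) / plucker B I * entry (B k) (I l))" for j
    proof -
      define v :: "real ^ 'm" where "v = (\<chi> k. entry (B k) j)"
      define a :: "real ^ 'm" where "a = (\<chi> l. plucker B (I(l := j)) / plucker B I)"
      have "(\<chi> i l'. if l' = l then v $ i else R $ i $ l') = (\<chi> k l'. B k $ fst ((I(l := j)) l') $ snd ((I(l := j)) l'))" for l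
        by (auto simp: vec_eq_iff v_def R_def entry_def)
      then have "a = (\<chi> l. det (\<chi> i l'. if l' = l then v $ i else R $ i $ l') / det R)"
        unfolding a_def plucker_def R[unfolded plucker_def] by simp
      then have "R *v a = v" using cramer[of R a v] p R by simp
      then have "(R *v a) $ k = v $ k" by simp
      then show ?thesis unfolding matrix_vector_mult_def R_def a_def v_def by (simp add: mult.commute)
    qed
    moreover have "B k \<in> sym_mats" using BL L by blast
    ultimately show ?thesis unfolding chart_space_def mem_Collect_eq case_prod_conv by blast
  qed
  then have sub: "L \<subseteq> ?C"
    unfolding span[symmetric] by (intro span_minimal subspace_chart_space) auto
  moreover have "x \<in> L" if x: "x \<in> ?C" for x
  proof -
    define \<xi> :: "real ^ 'm" where "\<xi> = (\<chi> l. entry x (I l))"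
    have "det (transpose R) \<noteq> 0" using R p by (simp add: det_transpose)
    then obtain c where c: "transpose R *v c = \<xi>" using cramer by blast
    define y where "y = (\<Sum>k\<in>UNIV. c $ k *\<^sub>R B k)"
    have "y \<in> L" unfolding y_def span[symmetric]
      by (intro span_sum span_mul span_base) auto
    moreover have "entry x (I l) = entry y (I l)" for l
    proof -
      have "\<xi> $ l = (transpose R *v c) $ l" using c by simp
      then show ?thesis unfolding \<xi>_def y_def R_def
        by (simp add: matrix_vector_mult_def transpose_def entry_simps mult.commute)
    qed
    ultimately show ?thesis using chart_space_eqI[OF x] sub by blast
  qed
  ultimately show ?thesis by blast
qed

definition chart_basis :: "('m::finite \<Rightarrow> 'n::finite \<times> 'n) \<Rightarrow> (('n \<times> 'n) \<times> 'm \<Rightarrow> real) \<Rightarrow> 'm \<Rightarrow> real ^ 'n ^ 'n" where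
  "chart_basis I a l = sym_of (\<lambda>p. if p \<in> range I then (if p = I l then 1 else 0) else a (p, l))"

context
  fixes I :: "'m::finite \<Rightarrow> 'n::finite \<times> 'n"
  assumes inj_chart: "inj I" and I_upper: "range I \<subseteq> upper"
begin

lemma entry_chart_basis: "entry (chart_basis I a l) (I k) = (if k = l then 1 else 0)"
  unfolding chart_basis_def using I_upper inj_chart by (subst entry_sym_of) (auto simp: inj_eq)

lemma chart_basis_in: "chart_basis I a l \<in> chart_space I a"
proof -
  have "entry (chart_basis I a l) j = a (j, l)" if "j \<in> upper - range I" for j
    using that unfolding chart_basis_def by (subst entry_sym_of) auto
  then have "\<forall>j\<in>upper - range I. entry (chart_basis I a l) j = (\<Sum>k\<in>UNIV. a (j, k) * entry (chart_basis I a l) (I k))"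
    by (simp add: entry_chart_basis if_distrib cong: if_cong)
  moreover have "chart_basis I a l \<in> sym_mats" unfolding chart_basis_def by (rule sym_of_sym)
  ultimately show ?thesis unfolding chart_space_def by blast
qed

lemma chart_space_expansion:
  assumes x: "x \<in> chart_space I a"
  shows "x = (\<Sum>l\<in>UNIV. entry x (I l) *\<^sub>R chart_basis I a l)"
proof (rule chart_space_eqI[OF x])
  show "(\<Sum>l\<in>UNIV. entry x (I l) *\<^sub>R chart_basis I a l) \<in> chart_space I a"
    by (intro subspace_sum subspace_scale subspace_chart_space chart_basis_in)
qed (simp add: entry_simps entry_chart_basis if_distrib cong: if_cong)

lemma chart_basis: "is_basis (chart_basis I a) (chart_space I a)"
proof -
  have inj: "inj (chart_basis I a)"
    by (rule injI) (metis entry_chart_basis[of a] zero_neq_one)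
  have "independent (range (chart_basis I a))"
  proof (rule independent_if_scalars_zero)
    fix f :: "real ^ 'n ^ 'n \<Rightarrow> real" and x
    assume z: "(\<Sum>x\<in>range (chart_basis I a). f x *\<^sub>R x) = 0" and "x \<in> range (chart_basis I a)"
    then obtain k where k: "x = chart_basis I a k" by blast
    have "(\<Sum>l\<in>UNIV. f (chart_basis I a l) *\<^sub>R chart_basis I a l) = 0"
      using z sum.reindex[OF inj, of "\<lambda>x. f x *\<^sub>R x"] by simp
    then have "entry (\<Sum>l\<in>UNIV. f (chart_basis I a l) *\<^sub>R chart_basis I a l) (I k) = 0"
      by (simp add: entry_simps)
    then show "f x = 0" unfolding k
      by (simp add: entry_simps entry_chart_basis if_distrib cong: if_cong)
  qed simp
  moreover have "span (range (chart_basis I a)) = chart_space I a"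
  proof
    show "span (range (chart_basis I a)) \<subseteq> chart_space I a"
      using chart_basis_in by (intro span_minimal subspace_chart_space) auto
    show "chart_space I a \<subseteq> span (range (chart_basis I a))"
    proof
      fix x assume "x \<in> chart_space I a"
      from chart_space_expansion[OF this] show "x \<in> span (range (chart_basis I a))"
        by (metis (no_types, lifting) rangeI span_base span_mul span_sum)
    qed
  qed
  ultimately show ?thesis using inj unfolding is_basis_def by blast
qed

lemma chart_space_grassmannian: "chart_space I a \<in> grassmannian CARD('m)"
proof -
  have "dim (chart_space I a) = CARD('m)"
    using chart_basis[of a] unfolding is_basis_def
    by (metis card_image dim_span_eq_card_independent)
  then show ?thesis unfolding grassmannian_def
    by (auto simp: subspace_chart_space) (auto simp: chart_space_def)
qed

lemma plucker_chart_basis: "plucker (chart_basis I a) I = 1"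
proof -
  have "(\<chi> k l. chart_basis I a k $ fst (I l) $ snd (I l)) = (mat 1 :: real ^ 'm ^ 'm)"
    using entry_chart_basis[unfolded entry_def, of a] by (auto simp: mat_def vec_eq_iff)
  then show ?thesis unfolding plucker_def by simp
qed

lemma plucker_chart_basis_upd:
  assumes "j \<in> upper - range I"
  shows "plucker (chart_basis I a) (I(l := j)) = a (j, l)"
proof -
  have sub: "chart_space I a \<subseteq> sym_mats" unfolding chart_space_def by blast
  have "entry (chart_basis I a l) j = b (j, l)" if "chart_basis I a l \<in> chart_space I b" for b
    using that assms unfolding chart_space_def
    by (simp add: entry_chart_basis if_distrib cong: if_cong)
  from this[of a] this[of "\<lambda>(j, l). plucker (chart_basis I a) (I(l := j)) / plucker (chart_basis I a) I"]
  show ?thesis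
    using chart_of_basis[OF chart_basis sub, of I] chart_basis_in[of a l]
    by (simp add: plucker_chart_basis)
qed

text \<open>The closed set is the zero locus of the homogenized polynomial. It contains every subspace outside
  the chart because the homogenization vanishes there, and it misses the subspace whose chart
  coefficients are a point where the polynomial is nonzero.\<close>
lemma thin_in_chart_imp_zariski:
  assumes E: "E \<subseteq> grassmannian CARD('m)"
    and th: "thin ((upper - range I) \<times> UNIV) {a. chart_space I a \<in> E}"
  shows "\<exists>X. zariski_closed TYPE('m) X \<and> X \<subset> grassmannian CARD('m) \<and> E \<subseteq> X"
proof -
  define V where "V = (upper - range I) \<times> (UNIV :: 'm set)"
  obtain G a1 where G: "polyn V G" "G a1 \<noteq> 0" "\<And>a. chart_space I a \<in> E \<Longrightarrow> G a = 0"
    using th unfolding thin_def V_def by blast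
  have "finite V" by simp
  from homogenize[OF G(1) this, of I "\<lambda>(j, l). I(l := j)"] obtain f N where f: "homogeneous f"
    "\<And>x. eval_mpoly f x = (if x I = 0 then 0 else x I ^ N * G (\<lambda>v. x (case v of (j, l) \<Rightarrow> I(l := j)) / x I))"
    by blast
  define X where "X = {L \<in> grassmannian CARD('m). \<forall>B. is_basis (B :: 'm \<Rightarrow> _) L \<longrightarrow> eval_mpoly f (plucker B) = 0}"
  have "zariski_closed TYPE('m) X"
    unfolding zariski_closed_def X_def using f(1) by (intro exI[of _ "{f}"]) auto
  moreover have "E \<subseteq> X"
  proof
    fix L assume L: "L \<in> E"
    have "eval_mpoly f (plucker B) = 0" if B: "is_basis B L" for B :: "'m \<Rightarrow> _"
    proof (cases "plucker B I = 0")
      case True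
      then show ?thesis by (simp add: f(2))
    next
      case False
      have "L \<subseteq> sym_mats" using L E unfolding grassmannian_def by blast
      from chart_of_basis[OF B this False] L
      have "G (\<lambda>(j, l). plucker B (I(l := j)) / plucker B I) = 0" by (intro G(3)) simp
      then show ?thesis by (simp add: f(2) case_prod_unfold)
    qed
    then show "L \<in> X" unfolding X_def using L E by blast
  qed
  moreover have "chart_space I a1 \<notin> X"
  proof
    assume "chart_space I a1 \<in> X"
    then have "eval_mpoly f (plucker (chart_basis I a1)) = 0"
      unfolding X_def using chart_basis by blast
    moreover have "G (\<lambda>v. plucker (chart_basis I a1) (case v of (j, l) \<Rightarrow> I(l := j)) / plucker (chart_basis I a1) I) = G a1"
      by (rule polyn_cong[OF G(1)]) (auto simp: V_def plucker_chart_basis plucker_chart_basis_upd)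
    ultimately show False using G(2) by (simp add: f(2) plucker_chart_basis)
  qed
  moreover have "X \<subseteq> grassmannian CARD('m)" unfolding X_def by blast
  ultimately show ?thesis using chart_space_grassmannian by blast
qed

end

section \<open>Parametrized low-rank matrices and their conormal matrices\<close>

text \<open>Both blocks read off their entries from a single family \<open>\<xi>\<close> of reals indexed by matrix
  positions. The blocks use disjoint sets of positions, collected in \<open>coords\<close> below.\<close>
definition diag_block :: "'n::finite set \<Rightarrow> ('n \<times> 'n \<Rightarrow> real) \<Rightarrow> real ^ 'n ^ 'n" where
  "diag_block S \<xi> = (\<chi> u v. if u \<in> S \<and> v \<in> S then \<xi> (fold_up (u, v)) else 0)"

definition off_block :: "'n::finite set \<Rightarrow> ('n \<times> 'n \<Rightarrow> real) \<Rightarrow> real ^ 'n ^ 'n" where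
  "off_block S \<xi> = (\<chi> u v. if u \<notin> S \<and> v \<in> S then \<xi> (u, v) else 0)"

definition param_mat :: "'n::finite set \<Rightarrow> ('n \<times> 'n \<Rightarrow> real) \<Rightarrow> real ^ 'n ^ 'n" where
  "param_mat S \<xi> = (mat 1 + off_block S \<xi>) ** diag_block S \<xi> ** transpose (mat 1 + off_block S \<xi>)"

definition sym_on :: "('n::finite \<times> 'n) set \<Rightarrow> ('n \<times> 'n \<Rightarrow> real) \<Rightarrow> real ^ 'n ^ 'n" where
  "sym_on N \<eta> = sym_of (\<lambda>p. if p \<in> N then \<eta> p else 0)"

text \<open>The change of coordinates dual to that in \<open>param_mat\<close>, since the inverse of \<open>1 + B\<close> is \<open>1 - B\<close>.
  Orthogonality to a space attached to \<open>param_mat S \<xi>\<close> becomes the vanishing of the entries outside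
  \<open>N\<close>. Two choices matter. For \<open>N = upper - S \<times> S\<close> these matrices are orthogonal to all symmetric
  matrices with columns in the span of the columns of \<open>1 + B\<close> at \<open>S\<close>. For \<open>N = upper \<inter> (-S) \<times> (-S)\<close>
  they annihilate that span.\<close>
definition conormal :: "'n::finite set \<Rightarrow> ('n \<times> 'n) set \<Rightarrow> ('n \<times> 'n \<Rightarrow> real) \<Rightarrow> ('n \<times> 'n \<Rightarrow> real) \<Rightarrow> real ^ 'n ^ 'n" where
  "conormal S N \<xi> \<eta> = transpose (mat 1 - off_block S \<xi>) ** sym_on N \<eta> ** (mat 1 - off_block S \<xi>)"

definition has_conormal :: "'n::finite set \<Rightarrow> ('n \<times> 'n) set \<Rightarrow> (real ^ 'n ^ 'n) set \<Rightarrow> ('n \<times> 'n \<Rightarrow> real) \<Rightarrow> bool" where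
  "has_conormal S N L \<xi> \<longleftrightarrow> param_mat S \<xi> \<in> L \<and> param_mat S \<xi> \<noteq> 0 \<and>
     (\<exists>\<eta>. conormal S N \<xi> \<eta> \<noteq> 0 \<and> (\<forall>x\<in>L. conormal S N \<xi> \<eta> \<bullet> x = 0))"

text \<open>The coefficient of the entry at \<open>p\<close> in the functional \<open>inner Y\<close> on symmetric matrices, where an
  off-diagonal position also stands for its transpose.\<close>
definition dual_coef :: "real ^ 'n ^ 'n \<Rightarrow> 'n \<times> 'n \<Rightarrow> real" where
  "dual_coef Y p = (if fst p = snd p then 1 else 2) * entry Y p"

lemma dual_coef_eq_0_iff: "dual_coef Y p = 0 \<longleftrightarrow> entry Y p = 0"
  by (simp add: dual_coef_def)

lemma sum_fold_up:
  fixes f :: "'n::finite \<times> 'n \<Rightarrow> real"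
  assumes "\<And>i j. f (j, i) = f (i, j)"
  shows "(\<Sum>p\<in>UNIV. f p) = (\<Sum>p\<in>upper. (if fst p = snd p then 1 else 2) * f p)"
proof -
  define lower where "lower = (\<lambda>(i, j). (j, i)) ` {p \<in> upper. fst p \<noteq> snd (p :: 'n \<times> 'n)}"
  have "(UNIV :: ('n \<times> 'n) set) = upper \<union> lower"
  proof -
    have "p \<in> upper \<union> lower" for p :: "'n \<times> 'n"
      unfolding lower_def upper_def by (cases p) (force simp: image_iff)
    then show ?thesis by blast
  qed
  moreover have "upper \<inter> lower = {}"
    unfolding lower_def upper_def by auto
  ultimately have "(\<Sum>p\<in>UNIV. f p) = (\<Sum>p\<in>upper. f p) + (\<Sum>p\<in>lower. f p)"
    using sum.union_disjoint[of upper lower f] by simp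
  also have "(\<Sum>p\<in>lower. f p) = (\<Sum>p\<in>{p \<in> upper. fst p \<noteq> snd p}. f p)"
    unfolding lower_def by (subst sum.reindex) (auto simp: inj_on_def assms intro!: sum.cong)
  also have "\<dots> = (\<Sum>p\<in>upper. if fst p \<noteq> snd p then f p else 0)"
    by (rule sum.inter_filter) simp
  finally show ?thesis
    by (simp add: sum.distrib[symmetric] if_distrib cong: if_cong) (auto intro!: sum.cong)
qed

lemma inner_sym:
  assumes "x \<in> sym_mats" "y \<in> sym_mats"
  shows "x \<bullet> y = (\<Sum>p\<in>upper. dual_coef x p * entry y p)"
proof -
  have "x \<bullet> y = (\<Sum>i\<in>UNIV. \<Sum>j\<in>UNIV. x $ i $ j * y $ i $ j)"
    by (simp add: inner_vec_def)
  also have "\<dots> = (\<Sum>p\<in>UNIV. entry x p * entry y p)"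
    by (simp add: sum.cartesian_product entry_def case_prod_unfold)
  also have "\<dots> = (\<Sum>p\<in>upper. (if fst p = snd p then 1 else 2) * (entry x p * entry y p))"
    by (rule sum_fold_up) (use assms in \<open>auto simp: entry_def sym_mats_entry\<close>)
  finally show ?thesis unfolding dual_coef_def by (simp add: mult.assoc)
qed

lemma sum_upper_split:
  fixes I :: "'m::finite \<Rightarrow> 'n::finite \<times> 'n"
  assumes "inj I" "range I \<subseteq> upper"
  shows "(\<Sum>p\<in>upper. f p) = (\<Sum>j\<in>upper - range I. f j) + (\<Sum>l\<in>UNIV. f (I l) :: real)"
proof -
  have "(\<Sum>p\<in>upper. f p) = (\<Sum>j\<in>upper - range I. f j) + (\<Sum>p\<in>range I. f p)"
    using assms(2) by (intro sum.subset_diff) auto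
  then show ?thesis using assms(1) by (simp add: sum.reindex)
qed

text \<open>Test orthogonality on the basis vector of \<open>chart_space I a\<close> with a single nonzero free entry.\<close>
lemma annihilator_dual_coef:
  fixes I :: "'m::finite \<Rightarrow> 'n::finite \<times> 'n"
  assumes I: "inj I" "range I \<subseteq> upper" and Y: "Y \<in> sym_mats" and ann: "\<And>x. x \<in> chart_space I a \<Longrightarrow> Y \<bullet> x = 0"
  shows "dual_coef Y (I l) = - (\<Sum>j\<in>upper - range I. dual_coef Y j * a (j, l))"
proof -
  let ?b = "chart_basis I a l"
  have b: "?b \<in> chart_space I a" by (rule chart_basis_in[OF I])
  have "entry ?b j = a (j, l)" if "j \<in> upper - range I" for j
    using b that unfolding chart_space_def
    by (simp add: entry_chart_basis[OF I] if_distrib cong: if_cong)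
  then have "(\<Sum>j\<in>upper - range I. dual_coef Y j * entry ?b j) = (\<Sum>j\<in>upper - range I. dual_coef Y j * a (j, l))"
    by (intro sum.cong) auto
  moreover have "0 = Y \<bullet> ?b" using ann b by simp
  moreover have "?b \<in> sym_mats" using b unfolding chart_space_def by blast
  ultimately show ?thesis
    using inner_sym[OF Y, of ?b] sum_upper_split[OF I, of "\<lambda>p. dual_coef Y p * entry ?b p"]
    by (simp add: entry_chart_basis[OF I] if_distrib cong: if_cong)
qed

lemma polyn_matrix_mult:
  assumes "\<And>i j. polyn S (\<lambda>x. A x $ i $ j)" "\<And>i j. polyn S (\<lambda>x. B x $ i $ j)"
  shows "polyn S (\<lambda>x. (A x ** B x) $ i $ j)"
  unfolding matrix_matrix_mult_def using assms by (auto intro!: polyn_sum polyn.mult)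

lemma polyn_off_block:
  assumes "\<And>s. polyn S (\<lambda>x. \<xi> x s)"
  shows "polyn S (\<lambda>x. (mat 1 + off_block Q (\<xi> x)) $ i $ j)" "polyn S (\<lambda>x. (mat 1 - off_block Q (\<xi> x)) $ i $ j)"
  unfolding off_block_def mat_def vector_add_component vector_minus_component vec_lambda_beta
  by (intro polyn.add polyn_diff polyn_if polyn.const assms)+

lemma polyn_transpose:
  assumes "\<And>i j. polyn S (\<lambda>x. A x $ i $ j)"
  shows "polyn S (\<lambda>x. transpose (A x) $ i $ j)"
  unfolding transpose_def using assms by simp

lemma polyn_param_mat:
  assumes "\<And>s. polyn S (\<lambda>x. \<xi> x s)"
  shows "polyn S (\<lambda>x. entry (param_mat Q (\<xi> x)) p)"
proof -
  have "polyn S (\<lambda>x. diag_block Q (\<xi> x) $ i $ j)" for i j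
    unfolding diag_block_def vec_lambda_beta by (intro polyn_if polyn.const assms)
  then show ?thesis unfolding param_mat_def entry_def
    by (intro polyn_matrix_mult polyn_transpose polyn_off_block assms)
qed

lemma polyn_conormal:
  assumes "\<And>s. polyn S (\<lambda>x. \<xi> x s)" "\<And>s. s \<in> N \<Longrightarrow> polyn S (\<lambda>x. \<eta> x s)"
  shows "polyn S (\<lambda>x. dual_coef (conormal Q N (\<xi> x) (\<eta> x)) p)"
proof -
  have "polyn S (\<lambda>x. sym_on N (\<eta> x) $ i $ j)" for i j
    unfolding sym_on_def sym_of_def vec_lambda_beta by (intro polyn_if polyn.const assms)
  then show ?thesis unfolding conormal_def dual_coef_def entry_def
    by (intro polyn_matrix_mult polyn_transpose polyn_off_block assms polyn.mult polyn_if polyn.const)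
qed

lemma sym_conj: "A \<in> sym_mats \<Longrightarrow> transpose P ** A ** P \<in> sym_mats"
  "A \<in> sym_mats \<Longrightarrow> P ** A ** transpose P \<in> sym_mats"
  unfolding sym_mats_def by (simp_all add: matrix_transpose_mul matrix_mul_assoc)

lemma conormal_sym: "conormal S N \<xi> \<eta> \<in> sym_mats"
  unfolding conormal_def sym_on_def by (intro sym_conj sym_of_sym)

lemma diag_block_sym: "diag_block S \<xi> \<in> sym_mats"
  by (auto simp: sym_mats_entry diag_block_def fold_up_swap)

lemma param_mat_sym: "param_mat S \<xi> \<in> sym_mats"
  unfolding param_mat_def by (intro sym_conj diag_block_sym)

lemma conormal_scale: "conormal S N \<xi> (\<lambda>p. c * \<eta> p) = c *\<^sub>R conormal S N \<xi> \<eta>"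
proof -
  have "sym_on N (\<lambda>p. c * \<eta> p) = c *\<^sub>R sym_on N \<eta>"
    unfolding sym_on_def sym_of_def by (simp add: vec_eq_iff)
  then show ?thesis unfolding conormal_def
    by (simp add: scalar_mult_eq_scaleR[symmetric] matrix_scalar_ac scalar_matrix_assoc)
qed

lemma conormal_0: "(\<And>p. p \<in> N \<Longrightarrow> \<eta> p = 0) \<Longrightarrow> conormal S N \<xi> \<eta> = 0"
proof -
  assume "\<And>p. p \<in> N \<Longrightarrow> \<eta> p = 0"
  then have "sym_on N \<eta> = 0" unfolding sym_on_def sym_of_def by (simp add: vec_eq_iff)
  then show ?thesis unfolding conormal_def by simp
qed

lemma thin_cong:
  assumes "thin V A"
  shows "thin V {z. \<exists>z'\<in>A. \<forall>v\<in>V. z v = z' v}"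
proof -
  obtain f x where f: "polyn V f" "f x \<noteq> 0" "\<And>z. z \<in> A \<Longrightarrow> f z = 0"
    using assms unfolding thin_def by blast
  have "f z = 0" if "z' \<in> A" "\<forall>v\<in>V. z v = z' v" for z z'
    using polyn_cong[OF f(1), of z z'] that f(3) by simp
  then show ?thesis unfolding thin_def using f by blast
qed

text \<open>Parametrization of all \<open>(a, \<xi>)\<close> for which \<open>param_mat S \<xi>\<close> lies in \<open>L = chart_space I a\<close> and some
  conormal matrix \<open>Y\<close> is orthogonal to \<open>L\<close>. Choose a free position \<open>I i0\<close> where \<open>\<Omega> = param_mat S \<xi>\<close>
  is nonzero, a dependent position \<open>j0\<close> where \<open>Y\<close> is nonzero, and scale \<open>Y\<close> so that its coordinate
  \<open>s1\<close> is 1. For \<open>j \<noteq> j0\<close> the equation of \<open>L\<close> with index \<open>j\<close>, evaluated at \<open>\<Omega>\<close>, determines \<open>a (j, i0)\<close>;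
  orthogonality to \<open>Y\<close> then determines all \<open>a (j0, l)\<close>. What remains free is \<open>\<xi>\<close> on \<open>P\<close>, the
  coordinates of \<open>Y\<close> on \<open>N - {s1}\<close>, and \<open>a\<close> without one row and one column. The hypothesis says that
  these are fewer than the coordinates of \<open>a\<close> and of \<open>\<xi>\<close> on \<open>K\<close> together.\<close>
lemma thin_has_conormal:
  fixes I :: "'m::finite \<Rightarrow> 'n::finite \<times> 'n"
  assumes I: "inj I" "range I \<subseteq> upper"
    and card: "upper - range I \<noteq> {} \<Longrightarrow> card P + card N + (card (upper - range I) - 1) * (CARD('m) - 1)
        \<le> card (upper - range I) * CARD('m) + card K"
  shows "thin (((upper - range I) \<times> UNIV) <+> K)
    {case_sum a t | a t. (a, t) \<in> {(a, t). \<exists>\<xi>. (\<forall>c\<in>K. \<xi> c = t c) \<and> (\<forall>s. s \<notin> P \<longrightarrow> \<xi> s = 1) \<and>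
       has_conormal S N (chart_space I a) \<xi>}}"
proof -
  define J where "J = upper - range I"
  define V where "V = (J \<times> (UNIV :: 'm set)) <+> K"
  define X where "X = (\<lambda>i0 j0 s1. {case_sum a t | a t. \<exists>\<xi> \<eta>. (\<forall>c\<in>K. \<xi> c = t c) \<and> (\<forall>s. s \<notin> P \<longrightarrow> \<xi> s = 1) \<and>
     param_mat S \<xi> \<in> chart_space I a \<and> entry (param_mat S \<xi>) (I i0) \<noteq> 0 \<and> \<eta> s1 = 1 \<and> 
     dual_coef (conormal S N \<xi> \<eta>) j0 \<noteq> 0 \<and> (\<forall>x\<in>chart_space I a. conormal S N \<xi> \<eta> \<bullet> x = 0)})"
  have thinX: "thin V (X i0 j0 s1)" if j0: "j0 \<in> J" and s1: "s1 \<in> N" for i0 j0 s1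
  proof -
    define T where "T = P <+> ((N - {s1}) <+> ((J - {j0}) \<times> (UNIV - {i0})))"
    define \<xi> where "\<xi> = (\<lambda>(x :: 'n \<times> 'n + ('n \<times> 'n + ('n \<times> 'n) \<times> 'm) \<Rightarrow> real) s. if s \<in> P then x (Inl s) else 1)"
    define \<eta> where "\<eta> = (\<lambda>(x :: 'n \<times> 'n + ('n \<times> 'n + ('n \<times> 'n) \<times> 'm) \<Rightarrow> real) s. if s = s1 then 1 else x (Inr (Inl s)))"
    define \<alpha> where "\<alpha> = (\<lambda>(x :: 'n \<times> 'n + ('n \<times> 'n + ('n \<times> 'n) \<times> 'm) \<Rightarrow> real) v. x (Inr (Inr v)))"
    define om where "om = (\<lambda>x. entry (param_mat S (\<xi> x)))"
    define y where "y = (\<lambda>x. dual_coef (conormal S N (\<xi> x) (\<eta> x)))"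
    define h where "h = (\<lambda>x. om x (I i0) * y x j0)"
    \<comment> \<open>\<open>na x j l / om x (I i0)\<close> is the entry \<open>a (j, l)\<close> for \<open>j \<noteq> j0\<close>.\<close>
    define na where "na = (\<lambda>x j l. if l = i0 then om x j - (\<Sum>l\<in>UNIV - {i0}. \<alpha> x (j, l) * om x (I l))
       else om x (I i0) * \<alpha> x (j, l))"
    define num where "num = (\<lambda>v x. case v of Inl (j, l) \<Rightarrow>
        if j \<noteq> j0 then y x j0 * na x j l else - (om x (I i0) * y x (I l)) - (\<Sum>j\<in>J - {j0}. y x j * na x j l)
      | Inr c \<Rightarrow> h x * \<xi> x c)"
    define \<phi> where "\<phi> = (\<lambda>x v. num v x / h x)"
    have p\<xi>: "polyn T (\<lambda>x. \<xi> x s)" for s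
      unfolding \<xi>_def T_def by (intro polyn_if polyn.const polyn.var) auto
    have p\<eta>: "polyn T (\<lambda>x. \<eta> x s)" if "s \<in> N" for s
      unfolding \<eta>_def T_def by (intro polyn_if polyn.const polyn.var) (use that in auto)
    have p\<alpha>: "polyn T (\<lambda>x. \<alpha> x (j, l))" if "j \<in> J - {j0}" "l \<noteq> i0" for j l
      unfolding \<alpha>_def T_def by (intro polyn.var) (use that in auto)
    have pom: "polyn T (\<lambda>x. om x p)" for p unfolding om_def by (intro polyn_param_mat p\<xi>)
    have py: "polyn T (\<lambda>x. y x p)" for p unfolding y_def by (intro polyn_conormal p\<xi> p\<eta>)
    have ph: "polyn T h" unfolding h_def by (intro polyn.mult pom py)
    have pna: "polyn T (\<lambda>x. na x j l)" if "j \<in> J - {j0}" for j l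
      unfolding na_def by (intro polyn_if polyn_diff polyn_sum polyn.mult pom p\<alpha> that) auto
    have pnum: "polyn T (num v)" if v: "v \<in> V" for v
    proof (cases v)
      case (Inr c)
      then show ?thesis unfolding num_def by (simp add: polyn.mult ph p\<xi>)
    next
      case (Inl w)
      obtain j l where w: "w = (j, l)" "j \<in> J" using v Inl unfolding V_def by (cases w) auto
      have "polyn T (\<lambda>x. if j \<noteq> j0 then y x j0 * na x j l else - (om x (I i0) * y x (I l)) - (\<Sum>j\<in>J - {j0}. y x j * na x j l))"
        by (intro polyn_if polyn_diff polyn_uminus polyn_sum polyn.mult pom py pna) (use w in auto)
      then show ?thesis unfolding num_def Inl w by simp
    qed
    have fin: "finite T" "finite V" unfolding T_def V_def by simp_all
    have "card T < card V"
    proof -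
      have "card T = card P + ((card N - 1) + (card J - 1) * (CARD('m) - 1))"
        unfolding T_def using j0 s1 by (simp add: card_Plus card_cartesian_product)
      moreover have "card V = card J * CARD('m) + card K"
        unfolding V_def by (simp add: card_Plus card_cartesian_product)
      moreover have "card N > 0" using s1 by (auto simp: card_gt_0_iff)
      moreover have "upper - range I \<noteq> {}" using j0 unfolding J_def by blast
      ultimately show ?thesis using card unfolding J_def by linarith
    qed
    have "thin V {\<phi> x | x. h x \<noteq> 0}"
      by (rule thin_rational_image[OF fin \<open>card T < card V\<close> pnum ph]) (simp_all add: \<phi>_def)
    then have "thin V {z. \<exists>z'\<in>{\<phi> x | x. h x \<noteq> 0}. \<forall>v\<in>V. z v = z' v}" by (rule thin_cong)
    moreover have "X i0 j0 s1 \<subseteq> {z. \<exists>z'\<in>{\<phi> x | x. h x \<noteq> 0}. \<forall>v\<in>V. z v = z' v}"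
    proof
      fix z assume "z \<in> X i0 j0 s1"
      then obtain a t \<xi>0 \<eta>0 where z: "z = case_sum a t" "\<forall>c\<in>K. \<xi>0 c = t c" "\<forall>s. s \<notin> P \<longrightarrow> \<xi>0 s = 1"
        "param_mat S \<xi>0 \<in> chart_space I a" "entry (param_mat S \<xi>0) (I i0) \<noteq> 0" "\<eta>0 s1 = 1"
        "dual_coef (conormal S N \<xi>0 \<eta>0) j0 \<noteq> 0" "\<forall>x\<in>chart_space I a. conormal S N \<xi>0 \<eta>0 \<bullet> x = 0"
        unfolding X_def by blast
      define x where "x = case_sum \<xi>0 (case_sum \<eta>0 a)"
      have \<xi>x: "\<xi> x = \<xi>0" using z(3) unfolding \<xi>_def x_def by auto
      have \<eta>x: "\<eta> x = \<eta>0" using z(6) unfolding \<eta>_def x_def by auto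
      have \<alpha>x: "\<alpha> x = a" unfolding \<alpha>_def x_def by auto
      have omx: "om x = entry (param_mat S \<xi>0)" unfolding om_def \<xi>x ..
      have yx: "y x = dual_coef (conormal S N \<xi>0 \<eta>0)" unfolding y_def \<xi>x \<eta>x ..
      have om0: "om x (I i0) \<noteq> 0" and y0: "y x j0 \<noteq> 0" using z omx yx by simp_all
      have na: "na x j l = om x (I i0) * a (j, l)" if "j \<in> J" for j l
      proof -
        have "om x j = (\<Sum>l\<in>UNIV. a (j, l) * om x (I l))"
          using z(4) that unfolding chart_space_def omx J_def by blast
        also have "\<dots> = a (j, i0) * om x (I i0) + (\<Sum>l\<in>UNIV - {i0}. a (j, l) * om x (I l))"
          by (rule sum.remove) auto
        finally show ?thesis unfolding na_def \<alpha>x by simp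
      qed
      have yI: "y x (I l) = - (y x j0 * a (j0, l) + (\<Sum>j\<in>J - {j0}. y x j * a (j, l)))" for l
      proof -
        have "y x (I l) = - (\<Sum>j\<in>J. y x j * a (j, l))"
          unfolding yx J_def using z(8) by (intro annihilator_dual_coef[OF I conormal_sym]) auto
        also have "(\<Sum>j\<in>J. y x j * a (j, l)) = y x j0 * a (j0, l) + (\<Sum>j\<in>J - {j0}. y x j * a (j, l))"
          by (rule sum.remove) (use j0 in auto)
        finally show ?thesis .
      qed
      have h0: "h x \<noteq> 0" unfolding h_def using om0 y0 by simp
      have "z v = \<phi> x v" if v: "v \<in> V" for v
      proof (cases v)
        case (Inr c)
        then show ?thesis using v z(1,2) h0 unfolding \<phi>_def num_def V_def by (auto simp: \<xi>x)
      next
        case (Inl w)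
        obtain j l where w: "w = (j, l)" "j \<in> J" using v Inl unfolding V_def by (cases w) auto
        have "num v x = h x * a (j, l)"
        proof (cases "j = j0")
          case True
          have "(\<Sum>j\<in>J - {j0}. y x j * na x j l) = (\<Sum>j\<in>J - {j0}. om x (I i0) * (y x j * a (j, l)))"
            by (rule sum.cong) (auto simp: na)
          then have "num v x = - (om x (I i0) * y x (I l)) - om x (I i0) * (\<Sum>j\<in>J - {j0}. y x j * a (j, l))"
            unfolding num_def Inl w True by (simp add: sum_distrib_left)
          then show ?thesis unfolding yI h_def True by (simp add: algebra_simps)
        next
          case False
          then show ?thesis unfolding num_def Inl w h_def by (simp add: na[OF w(2)])
        qed
        then show ?thesis using h0 unfolding \<phi>_def z(1) Inl w by simp
      qed
      then show "z \<in> {z. \<exists>z'\<in>{\<phi> x | x. h x \<noteq> 0}. \<forall>v\<in>V. z v = z' v}" using h0 by blast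
    qed
    ultimately show ?thesis by (rule thin_subset)
  qed
  have "thin V (\<Union>(i0, j0, s1)\<in>UNIV \<times> J \<times> N. X i0 j0 s1)"
    by (rule thin_UN) (auto intro: thinX)
  moreover have "{case_sum a t | a t. (a, t) \<in> {(a, t). \<exists>\<xi>. (\<forall>c\<in>K. \<xi> c = t c) \<and> (\<forall>s. s \<notin> P \<longrightarrow> \<xi> s = 1) \<and>
       has_conormal S N (chart_space I a) \<xi>}} \<subseteq> (\<Union>(i0, j0, s1)\<in>UNIV \<times> J \<times> N. X i0 j0 s1)"
  proof
    fix z assume "z \<in> {case_sum a t | a t. (a, t) \<in> {(a, t). \<exists>\<xi>. (\<forall>c\<in>K. \<xi> c = t c) \<and> (\<forall>s. s \<notin> P \<longrightarrow> \<xi> s = 1) \<and>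
       has_conormal S N (chart_space I a) \<xi>}}"
    then obtain a t \<xi> \<eta> where z: "z = case_sum a t" "\<forall>c\<in>K. \<xi> c = t c" "\<forall>s. s \<notin> P \<longrightarrow> \<xi> s = 1"
      "param_mat S \<xi> \<in> chart_space I a" "param_mat S \<xi> \<noteq> 0" "conormal S N \<xi> \<eta> \<noteq> 0"
      "\<forall>x\<in>chart_space I a. conormal S N \<xi> \<eta> \<bullet> x = 0"
      unfolding has_conormal_def by blast
    have "0 \<in> chart_space I a" using subspace_chart_space by (rule subspace_0)
    with chart_space_eqI[OF z(4) this] z(5) obtain i0 where i0: "entry (param_mat S \<xi>) (I i0) \<noteq> 0"
      unfolding entry_0 by blast
    obtain s1 where s1: "s1 \<in> N" "\<eta> s1 \<noteq> 0" using z(6) conormal_0 by blast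
    define \<eta>' where "\<eta>' = (\<lambda>p. inverse (\<eta> s1) * \<eta> p)"
    have Y': "conormal S N \<xi> \<eta>' = inverse (\<eta> s1) *\<^sub>R conormal S N \<xi> \<eta>"
      unfolding \<eta>'_def by (rule conormal_scale)
    then have Y0: "conormal S N \<xi> \<eta>' \<noteq> 0" using s1 z(6) by simp
    have ann: "\<forall>x\<in>chart_space I a. conormal S N \<xi> \<eta>' \<bullet> x = 0" using z(7) unfolding Y' by simp
    have "\<exists>j0\<in>J. dual_coef (conormal S N \<xi> \<eta>') j0 \<noteq> 0"
    proof (rule ccontr)
      assume c: "\<not> ?thesis"
      have "dual_coef (conormal S N \<xi> \<eta>') (I l) = 0" for l
        using annihilator_dual_coef[OF I conormal_sym, of a S N \<xi> \<eta>' l] ann c unfolding J_def by simp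
      then have "dual_coef (conormal S N \<xi> \<eta>') p = 0" if "p \<in> upper" for p
        using c that unfolding J_def by (cases "p \<in> range I") auto
      then have e: "entry (conormal S N \<xi> \<eta>') p = 0" if "p \<in> upper" for p
        using that by (simp add: dual_coef_eq_0_iff)
      have "conormal S N \<xi> \<eta>' = 0"
        by (rule sym_mats_eqI[OF conormal_sym subspace_0[OF subspace_sym_mats]]) (simp only: e entry_0)
      then show False using Y0 by simp
    qed
    then obtain j0 where j0: "j0 \<in> J" "dual_coef (conormal S N \<xi> \<eta>') j0 \<noteq> 0" by blast
    have "z \<in> X i0 j0 s1" unfolding X_def
      using z i0 j0(2) ann s1(2) by (intro CollectI exI[of _ a] exI[of _ t] exI[of _ \<xi>] exI[of _ \<eta>'] conjI) (auto simp: \<eta>'_def)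
    then show "z \<in> (\<Union>(i0, j0, s1)\<in>UNIV \<times> J \<times> N. X i0 j0 s1)" using j0(1) s1(1) by blast
  qed
  ultimately show ?thesis unfolding V_def J_def by (rule thin_subset)
qed

section \<open>Positive semidefinite matrices in the parametrization\<close>

definition supported :: "'n::finite set \<Rightarrow> (real ^ 'n) set" where
  "supported S = {z. \<forall>i. i \<notin> S \<longrightarrow> z $ i = 0}"

definition nondegenerate_on :: "'n::finite set \<Rightarrow> ('n \<times> 'n \<Rightarrow> real) \<Rightarrow> bool" where
  "nondegenerate_on S \<xi> \<longleftrightarrow> (\<forall>z\<in>supported S. diag_block S \<xi> *v z = 0 \<longrightarrow> z = 0)"

definition positive_on :: "'n::finite set \<Rightarrow> ('n \<times> 'n \<Rightarrow> real) \<Rightarrow> bool" where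
  "positive_on S \<xi> \<longleftrightarrow> (\<forall>z\<in>supported S. z \<noteq> 0 \<longrightarrow> 0 < z \<bullet> (diag_block S \<xi> *v z))"

lemma positive_on_nondegenerate: "positive_on S \<xi> \<Longrightarrow> nondegenerate_on S \<xi>"
  unfolding positive_on_def nondegenerate_on_def by (metis inner_zero_right less_irrefl)

lemma subspace_supported: "subspace (supported S)"
  unfolding supported_def subspace_def by auto

lemma dim_supported: "dim (supported S) = card S"
  unfolding supported_def using dim_substandard_cart[of S, where 'a = real] by (simp add: dim_vec_eq)

lemma inner_matrix_vector: "x \<bullet> (M *v y) = (transpose M *v x) \<bullet> (y :: real ^ 'n)" for M :: "real ^ 'n ^ 'm"
  by (metis dot_lmul_matrix transpose_matrix_vector)

lemma transpose_zero: "transpose 0 = 0"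
  by (simp add: transpose_def vec_eq_iff)

lemma inner_eq_trace: "x \<bullet> y = trace (transpose x ** y)" for x y :: "real ^ 'n ^ 'm"
proof -
  have "x \<bullet> y = (\<Sum>k\<in>UNIV. \<Sum>i\<in>UNIV. x $ k $ i * y $ k $ i)" by (simp add: inner_vec_def)
  also have "\<dots> = (\<Sum>i\<in>UNIV. \<Sum>k\<in>UNIV. x $ k $ i * y $ k $ i)" by (rule sum.swap)
  finally show ?thesis by (simp add: trace_def matrix_matrix_mult_def transpose_def)
qed

lemma inner_matrix_conj: "Y \<bullet> (P ** C ** Q) = (transpose P ** Y ** transpose Q) \<bullet> (C :: real ^ 'n ^ 'n)"
proof -
  have "Y \<bullet> (P ** C ** Q) = trace ((transpose Y ** P ** C) ** Q)"
    by (simp add: inner_eq_trace matrix_mul_assoc)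
  also have "\<dots> = trace (Q ** (transpose Y ** P ** C))" by (rule trace_mul_sym)
  also have "\<dots> = (transpose P ** Y ** transpose Q) \<bullet> C"
    by (simp add: inner_eq_trace matrix_mul_assoc matrix_transpose_mul)
  finally show ?thesis .
qed

lemma off_block_square: "off_block S \<xi> ** off_block S \<xi> = 0"
proof -
  have "(\<Sum>w\<in>UNIV. off_block S \<xi> $ u $ w * off_block S \<xi> $ w $ v) = 0" for u v
    by (rule sum.neutral) (simp add: off_block_def)
  then show ?thesis by (simp add: vec_eq_iff matrix_matrix_mult_def)
qed

lemma matrix_mul_diff_left: "(A - B) ** C = A ** C - B ** (C :: real ^ 'n ^ 'm)" for A B :: "real ^ 'm ^ 'l"
  by (simp add: vec_eq_iff matrix_matrix_mult_def left_diff_distrib sum_subtractf)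

lemma matrix_mul_diff_right: "C ** (A - B) = C ** A - C ** (B :: real ^ 'n ^ 'm)" for C :: "real ^ 'm ^ 'l"
  by (simp add: vec_eq_iff matrix_matrix_mult_def right_diff_distrib sum_subtractf)

lemma matrix_mul_add_left: "(A + B) ** C = A ** C + B ** (C :: real ^ 'n ^ 'm)" for A B :: "real ^ 'm ^ 'l"
  by (simp add: vec_eq_iff matrix_matrix_mult_def distrib_right sum.distrib)

lemma shear_inverse:
  "(mat 1 + off_block S \<xi>) ** (mat 1 - off_block S \<xi>) = mat 1"
  "(mat 1 - off_block S \<xi>) ** (mat 1 + off_block S \<xi>) = mat 1"
  by (simp_all add: matrix_mul_diff_left matrix_mul_diff_right matrix_mul_add_left matrix_add_ldistrib off_block_square)

lemma shear_inverse_transpose: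
  "transpose (mat 1 + off_block S \<xi>) ** transpose (mat 1 - off_block S \<xi>) = mat 1"
  "transpose (mat 1 - off_block S \<xi>) ** transpose (mat 1 + off_block S \<xi>) = mat 1"
  by (simp_all add: shear_inverse transpose_mat flip: matrix_transpose_mul)

lemma conj_inverse:
  fixes P Q M :: "real ^ 'n ^ 'n"
  assumes "P ** Q = mat 1" "Q' ** P' = mat 1"
  shows "P ** (Q ** M ** Q') ** P' = M"
proof -
  have "P ** (Q ** M ** Q') ** P' = (P ** Q) ** M ** (Q' ** P')" by (simp add: matrix_mul_assoc)
  then show ?thesis using assms by simp
qed

text \<open>Inverting the shear by \<open>1 + B\<close>; this makes \<open>param_mat S \<xi>\<close> and its diagonal block bound each
  other's rank.\<close>
lemma diag_block_recover:
  "(mat 1 - off_block S \<xi>) ** param_mat S \<xi> ** transpose (mat 1 - off_block S \<xi>) = diag_block S \<xi>"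
  unfolding param_mat_def by (rule conj_inverse) (rule shear_inverse shear_inverse_transpose)+

lemma diag_block_mult_supported: "diag_block S \<xi> *v z \<in> supported S"
  unfolding supported_def diag_block_def matrix_vector_mult_def by simp

lemma diag_block_range:
  assumes "nondegenerate_on S \<xi>"
  shows "(*v) (diag_block S \<xi>) ` supported S = supported S"
proof -
  let ?A = "(*v) (diag_block S \<xi>)"
  have lin: "linear ?A" by simp
  have inj: "inj_on ?A (supported S)"
    using assms linear_inj_on_iff_eq_0[OF lin subspace_supported] unfolding nondegenerate_on_def by blast
  have span: "span (supported S) = supported S" by (simp add: subspace_supported span_eq_iff)
  have "dim (?A ` supported S) = dim (supported S)"
    using dim_image_eq[OF lin] inj span by metis
  moreover have "?A ` supported S \<subseteq> supported S" using diag_block_mult_supported by blast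
  moreover have "subspace (?A ` supported S)" using lin subspace_supported by (rule linear_subspace_image)
  ultimately show ?thesis using subspace_dim_equal subspace_supported by (metis order_refl)
qed

lemma rank_param_mat:
  assumes "nondegenerate_on S \<xi>"
  shows "rank (param_mat S \<xi>) = card S"
proof -
  let ?A = "diag_block S \<xi>"
  have "rank (param_mat S \<xi>) \<le> rank ?A" unfolding param_mat_def
    by (meson order_trans rank_mul_le_left rank_mul_le_right)
  moreover have "rank ?A \<le> rank (param_mat S \<xi>)"
    by (subst diag_block_recover[of S \<xi>, symmetric]) (meson order_trans rank_mul_le_left rank_mul_le_right)
  moreover have "range ((*v) ?A) = supported S"
    using diag_block_range[OF assms] diag_block_mult_supported by blast
  ultimately show ?thesis by (simp add: rank_dim_range dim_supported)
qed

lemma param_mat_quadratic: "x \<bullet> (param_mat S \<xi> *v x) = (transpose (mat 1 + off_block S \<xi>) *v x) \<bullet> (diag_block S \<xi> *v (transpose (mat 1 + off_block S \<xi>) *v x))"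
  unfolding param_mat_def by (simp add: matrix_vector_mul_assoc[symmetric] inner_matrix_vector)

lemma psd_param_mat:
  assumes "positive_on S \<xi>"
  shows "psd (param_mat S \<xi>)"
proof -
  have "0 \<le> w \<bullet> (diag_block S \<xi> *v w)" for w
  proof -
    define z :: "real ^ 'a" where "z = (\<chi> i. if i \<in> S then w $ i else 0)"
    have "diag_block S \<xi> *v w = diag_block S \<xi> *v z"
      unfolding diag_block_def matrix_vector_mult_def z_def by (auto simp: vec_eq_iff intro!: sum.cong)
    moreover have "w \<bullet> (diag_block S \<xi> *v z) = z \<bullet> (diag_block S \<xi> *v z)"
      unfolding inner_vec_def by (rule sum.cong) (use diag_block_mult_supported[of S \<xi> z] in \<open>auto simp: z_def supported_def\<close>)
    moreover have "z \<in> supported S" unfolding z_def supported_def by simp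
    ultimately show ?thesis using assms unfolding positive_on_def
      by (cases "z = 0") (auto intro: less_imp_le)
  qed
  then show ?thesis unfolding psd_def param_mat_quadratic using param_mat_sym by blast
qed

text \<open>If \<open>w = A z\<close> were nonzero, the form would be negative at \<open>z - t w\<close> for small \<open>t > 0\<close>, its linear
  term in \<open>t\<close> being \<open>-2 t (w \<bullet> w)\<close>.\<close>
lemma psd_isotropic_imp_kernel:
  assumes A: "A \<in> sym_mats" and psd: "\<And>x. 0 \<le> x \<bullet> (A *v x)" and z: "z \<bullet> (A *v z) = 0"
  shows "A *v z = 0"
proof -
  define w where "w = A *v z"
  define c where "c = w \<bullet> (A *v w)"
  have Asym: "transpose A = A" using A unfolding sym_mats_def by simp
  have zw: "z \<bullet> (A *v w) = w \<bullet> w" using inner_matrix_vector[of z A w] unfolding w_def Asym .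
  have q: "0 \<le> t * (c * t - 2 * (w \<bullet> w))" for t
  proof -
    have "(z - t *\<^sub>R w) \<bullet> (A *v (z - t *\<^sub>R w)) = z \<bullet> (A *v z) - t * (w \<bullet> (A *v z)) - t * (z \<bullet> (A *v w)) + t * t * c"
      by (simp add: matrix_vector_mult_diff_distrib scaleR_matrix_vector_assoc[symmetric] matrix_vector_mult_scaleR inner_diff_left inner_diff_right c_def algebra_simps)
    also have "\<dots> = t * (c * t - 2 * (w \<bullet> w))" using z zw by (simp add: w_def[symmetric] algebra_simps)
    finally show ?thesis using psd by metis
  qed
  have "w \<bullet> w = 0"
  proof (rule ccontr)
    assume "w \<bullet> w \<noteq> 0"
    then have p: "w \<bullet> w > 0" by simp
    have c: "c \<ge> 0" unfolding c_def by (rule psd)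
    define t where "t = (w \<bullet> w) / (c + 1)"
    have t: "t > 0" unfolding t_def using p c by simp
    have "c * t \<le> w \<bullet> w" unfolding t_def using p c by (simp add: field_simps)
    then have "c * t - 2 * (w \<bullet> w) < 0" using p by linarith
    then have "t * (c * t - 2 * (w \<bullet> w)) < 0" using t by (rule mult_pos_neg[rotated])
    then show False using q[of t] by linarith
  qed
  then show ?thesis unfolding w_def by simp
qed

lemma psd_param_mat_imp_positive_on:
  assumes nd: "nondegenerate_on S \<xi>" and psd: "psd (param_mat S \<xi>)"
  shows "positive_on S \<xi>"
proof -
  have ge: "0 \<le> z \<bullet> (diag_block S \<xi> *v z)" for z
  proof -
    have "z = transpose (mat 1 + off_block S \<xi>) *v (transpose (mat 1 - off_block S \<xi>) *v z)"
      by (simp only: matrix_vector_mul_assoc shear_inverse_transpose matrix_vector_mul_lid)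
    then show ?thesis using psd param_mat_quadratic unfolding psd_def by metis
  qed
  show ?thesis unfolding positive_on_def
  proof (intro ballI impI)
    fix z assume z: "z \<in> supported S" "z \<noteq> 0"
    have "z \<bullet> (diag_block S \<xi> *v z) \<noteq> 0"
      using psd_isotropic_imp_kernel[OF diag_block_sym ge] nd z unfolding nondegenerate_on_def by blast
    then show "0 < z \<bullet> (diag_block S \<xi> *v z)" using ge[of z] by linarith
  qed
qed

text \<open>The quadratic form has a positive minimum \<open>\<mu>\<close> on the compact unit sphere of \<open>supported S\<close>, and
  changing each entry by less than \<open>\<mu> / n\<^sup>2\<close> changes it there by less than \<open>\<mu>\<close>.\<close>
lemma positive_on_open:
  assumes "positive_on S \<xi>"
  shows "\<exists>e>0. \<forall>\<xi>'. (\<forall>p. \<bar>\<xi>' p - \<xi> p\<bar> < e) \<longrightarrow> positive_on S \<xi>'"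
proof -
  define C where "C = supported S \<inter> sphere (0 :: real ^ 'a) 1"
  define q where "q = (\<lambda>\<xi> (z :: real ^ 'a). z \<bullet> (diag_block S \<xi> *v z))"
  have "compact C" unfolding C_def
    by (intro closed_Int_compact closed_subspace subspace_supported compact_sphere)
  moreover have "continuous_on C (q \<xi>)" unfolding q_def
    by (intro continuous_intros matrix_vector_mult_linear_continuous_on)
  moreover have "\<And>z. z \<in> C \<Longrightarrow> 0 < q \<xi> z"
    using assms unfolding C_def q_def positive_on_def by auto
  ultimately have "\<exists>\<mu>>0. \<forall>z\<in>C. \<mu> \<le> q \<xi> z"
    by (cases "C = {}") (auto dest: continuous_attains_inf intro: exI[of _ 1])
  then obtain \<mu> where \<mu>: "\<mu> > 0" "\<And>z. z \<in> C \<Longrightarrow> \<mu> \<le> q \<xi> z" by blast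
  define n where "n = real CARD('a)"
  have n: "n > 0" unfolding n_def by simp
  define e where "e = \<mu> / (n * n)"
  have "positive_on S \<xi>'" if \<xi>': "\<And>p. \<bar>\<xi>' p - \<xi> p\<bar> < e" for \<xi>'
  proof -
    have "0 < q \<xi>' z" if z: "z \<in> C" for z
    proof -
      have nz: "\<bar>z $ i\<bar> \<le> 1" for i using component_le_norm_cart[of z i] z unfolding C_def by simp
      have "\<bar>q \<xi>' z - q \<xi> z\<bar> = \<bar>\<Sum>i\<in>UNIV. \<Sum>j\<in>UNIV. z $ i * (diag_block S \<xi>' $ i $ j - diag_block S \<xi> $ i $ j) * z $ j\<bar>"
        unfolding q_def inner_vec_def matrix_vector_mult_def
        by (simp add: sum_distrib_left sum_subtractf[symmetric] algebra_simps)
      also have "\<dots> \<le> (\<Sum>i\<in>UNIV. \<Sum>j\<in>UNIV. \<bar>z $ i * (diag_block S \<xi>' $ i $ j - diag_block S \<xi> $ i $ j) * z $ j\<bar>)"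
        by (intro order_trans[OF sum_abs] sum_mono sum_abs)
      also have "\<dots> < (\<Sum>i\<in>(UNIV :: 'a set). \<Sum>j\<in>(UNIV :: 'a set). e)"
      proof (intro sum_strict_mono)
        fix i j
        have "\<bar>diag_block S \<xi>' $ i $ j - diag_block S \<xi> $ i $ j\<bar> < e"
          unfolding diag_block_def using \<xi>' \<mu>(1) n by (auto simp: e_def)
        then have "\<bar>diag_block S \<xi>' $ i $ j - diag_block S \<xi> $ i $ j\<bar> * (\<bar>z $ i\<bar> * \<bar>z $ j\<bar>) < e"
          using nz[of i] nz[of j] mult_le_one[of "\<bar>z $ i\<bar>" "\<bar>z $ j\<bar>"]
          by (smt (verit) abs_ge_zero mult_left_le mult_nonneg_nonneg)
        then show "\<bar>z $ i * (diag_block S \<xi>' $ i $ j - diag_block S \<xi> $ i $ j) * z $ j\<bar> < e"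
          by (simp add: abs_mult mult_ac)
      qed auto
      also have "\<dots> = \<mu>" unfolding e_def n_def by simp
      finally show ?thesis using \<mu>(2)[OF z] by linarith
    qed
    note pos = this
    show ?thesis unfolding positive_on_def
    proof (intro ballI impI)
      fix z assume z: "z \<in> supported S" "z \<noteq> 0"
      define y where "y = inverse (norm z) *\<^sub>R z"
      have "y \<in> C" unfolding C_def y_def using z subspace_scale[OF subspace_supported z(1)] by simp
      then have "0 < q \<xi>' y" by (rule pos)
      also have "q \<xi>' y = inverse (norm z) * (inverse (norm z) * q \<xi>' z)"
        unfolding q_def y_def by (simp add: matrix_vector_mult_scaleR)
      finally show "0 < z \<bullet> (diag_block S \<xi>' *v z)" using z(2) unfolding q_def
        by (simp add: zero_less_mult_iff)
    qed
  qed
  moreover have "e > 0" unfolding e_def using \<mu>(1) n by simp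
  ultimately show ?thesis by blast
qed

text \<open>\<open>S\<close> indexes a basis of the column space among the columns, and \<open>B\<close> records how the other columns
  depend on it. Subtracting these dependencies from rows and columns leaves the block on \<open>S \<times> S\<close>.\<close>
lemma sym_factorization:
  fixes \<Omega> :: "real ^ 'n::finite ^ 'n"
  assumes sym: "\<Omega> \<in> sym_mats"
  obtains S \<xi> where "card S = rank \<Omega>" "param_mat S \<xi> = \<Omega>" "nondegenerate_on S \<xi>"
proof -
  obtain B where B: "B \<subseteq> columns \<Omega>" "independent B" "columns \<Omega> \<subseteq> span B" "card B = dim (columns \<Omega>)"
    using basis_exists by blast
  have "columns \<Omega> = (\<lambda>i. column i \<Omega>) ` UNIV" unfolding columns_def by auto
  then obtain S where S: "inj_on (\<lambda>i. column i \<Omega>) S" "B = (\<lambda>i. column i \<Omega>) ` S"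
    using B(1) subset_image_inj[of B "\<lambda>i. column i \<Omega>" UNIV] by auto
  have cardS: "card S = rank \<Omega>" using S B(4) by (simp add: card_image column_rank_def)
  have "\<exists>b. column u \<Omega> = (\<Sum>v\<in>S. b v *\<^sub>R column v \<Omega>)" for u
  proof -
    have "column u \<Omega> \<in> span B" using B(3) unfolding columns_def by auto
    moreover have "finite B" using S(2) by simp
    ultimately obtain f where "column u \<Omega> = (\<Sum>x\<in>B. f x *\<^sub>R x)" by (auto simp: span_finite)
    then show ?thesis unfolding S(2) sum.reindex[OF S(1)] by auto
  qed
  then obtain b where b: "\<And>u. column u \<Omega> = (\<Sum>v\<in>S. b u v *\<^sub>R column v \<Omega>)" by metis
  define Gi where "Gi = mat 1 - off_block S (\<lambda>(u, v). b u v)"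
  define A where "A = Gi ** \<Omega> ** transpose Gi"
  \<comment> \<open>Column operations clear the columns outside \<open>S\<close> and leave those in \<open>S\<close> unchanged.\<close>
  have colS: "(\<Omega> ** transpose Gi) $ w $ u = (if u \<in> S then \<Omega> $ w $ u else 0)" for w u
  proof -
    have "(\<Omega> ** transpose Gi) $ w $ u = (\<Sum>v\<in>UNIV. \<Omega> $ w $ v * ((if u = v then 1 else 0) - (if u \<notin> S \<and> v \<in> S then b u v else 0)))"
      unfolding Gi_def matrix_matrix_mult_def transpose_def off_block_def mat_def by (simp cong: if_cong)
    also have "\<dots> = \<Omega> $ w $ u - (\<Sum>v\<in>UNIV. if u \<notin> S \<and> v \<in> S then b u v * \<Omega> $ w $ v else 0)"
    proof -
      have "(\<Sum>v\<in>UNIV. \<Omega> $ w $ v * (if u = v then 1 else 0)) = \<Omega> $ w $ u"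
        by (simp add: if_distrib cong: if_cong)
      moreover have "(\<Sum>v\<in>UNIV. \<Omega> $ w $ v * (if u \<notin> S \<and> v \<in> S then b u v else 0)) =
          (\<Sum>v\<in>UNIV. if u \<notin> S \<and> v \<in> S then b u v * \<Omega> $ w $ v else 0)"
        by (rule sum.cong) auto
      ultimately show ?thesis by (simp only: right_diff_distrib sum_subtractf)
    qed
    also have "(\<Sum>v\<in>UNIV. if u \<notin> S \<and> v \<in> S then b u v * \<Omega> $ w $ v else 0) = (if u \<in> S then 0 else \<Omega> $ w $ u)"
    proof (cases "u \<in> S")
      case False
      have "(\<Sum>v\<in>UNIV. if v \<in> S then b u v * \<Omega> $ w $ v else 0) = (\<Sum>v\<in>S. b u v * \<Omega> $ w $ v)"
        by (simp add: sum.If_cases)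
      also have "\<dots> = column u \<Omega> $ w" unfolding b[of u] by (simp add: column_def)
      finally show ?thesis using False by (simp add: column_def)
    qed simp
    finally show ?thesis by simp
  qed
  have Asym: "A \<in> sym_mats" unfolding A_def by (rule sym_conj(2)[OF sym])
  have "A $ w $ u = 0" if "u \<notin> S" for w u
  proof -
    have "A $ w $ u = (\<Sum>v\<in>UNIV. Gi $ w $ v * (\<Omega> ** transpose Gi) $ v $ u)"
      unfolding A_def matrix_mul_assoc[symmetric] by (simp add: matrix_matrix_mult_def)
    then show ?thesis using that by (simp add: colS)
  qed
  then have A0: "A $ w $ u = 0" if "u \<notin> S \<or> w \<notin> S" for w u
    using that Asym unfolding sym_mats_entry by metis
  define \<xi> where "\<xi> = (\<lambda>(u, v). if u \<in> S \<and> v \<in> S then A $ u $ v else b u v)"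
  have off: "off_block S \<xi> = off_block S (\<lambda>(u, v). b u v)"
    unfolding off_block_def \<xi>_def by (auto simp: vec_eq_iff)
  have "\<xi> (fold_up (u, v)) = A $ u $ v" if "u \<in> S" "v \<in> S" for u v
    using fold_up_cases[of u v] that Asym unfolding \<xi>_def sym_mats_entry by auto
  then have diag: "diag_block S \<xi> = A"
    unfolding diag_block_def using A0 by (auto simp: vec_eq_iff)
  have G: "Gi = mat 1 - off_block S \<xi>" unfolding Gi_def off ..
  have "param_mat S \<xi> = \<Omega>" unfolding param_mat_def diag A_def G
    by (rule conj_inverse) (rule shear_inverse shear_inverse_transpose)+
  moreover have "nondegenerate_on S \<xi>" unfolding nondegenerate_on_def
  proof (intro ballI impI)
    fix z assume z: "z \<in> supported S" "diag_block S \<xi> *v z = 0"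
    have "(\<Omega> ** transpose Gi) *v z = (mat 1 + off_block S \<xi>) *v (A *v z)"
      unfolding A_def G by (simp add: matrix_vector_mul_assoc matrix_mul_assoc shear_inverse)
    then have "(\<Omega> ** transpose Gi) *v z = 0" using z(2) diag by simp
    moreover have "((\<Omega> ** transpose Gi) *v z) $ w = (\<Sum>u\<in>S. z $ u *\<^sub>R column u \<Omega>) $ w" for w
    proof -
      have "((\<Omega> ** transpose Gi) *v z) $ w = (\<Sum>u\<in>UNIV. if u \<in> S then z $ u * \<Omega> $ w $ u else 0)"
        unfolding matrix_vector_mult_def vec_lambda_beta by (rule sum.cong) (auto simp: colS)
      then show ?thesis by (simp add: column_def sum.If_cases)
    qed
    ultimately have "(\<Sum>u\<in>S. z $ u *\<^sub>R column u \<Omega>) = 0" by (simp add: vec_eq_iff)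
    moreover have "(\<Sum>x\<in>B. z $ (inv_into S (\<lambda>i. column i \<Omega>) x) *\<^sub>R x) = (\<Sum>u\<in>S. z $ u *\<^sub>R column u \<Omega>)"
      unfolding S(2) sum.reindex[OF S(1)] by (rule sum.cong) (auto simp: inv_into_f_f[OF S(1)])
    ultimately have "\<forall>x\<in>B. z $ (inv_into S (\<lambda>i. column i \<Omega>) x) = 0"
      using B(2) S(2) by (intro ballI independentD[of B B]) auto
    then have "z $ u = 0" if "u \<in> S" for u
      using that unfolding S(2) by (auto simp: inv_into_f_f[OF S(1)])
    then show "z = 0" using z(1) unfolding supported_def by (auto simp: vec_eq_iff)
  qed
  ultimately show ?thesis using that cardS by blast
qed

section \<open>Conormal matrices from failing transversality\<close>

lemma conormal_of_conj:
  fixes Y :: "real ^ 'n::finite ^ 'n"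
  assumes Y: "Y \<in> sym_mats"
    and z: "\<And>u v. (u, v) \<in> upper \<Longrightarrow> (u, v) \<notin> N \<Longrightarrow> (transpose (mat 1 + off_block S \<xi>) ** Y ** (mat 1 + off_block S \<xi>)) $ u $ v = 0"
  shows "\<exists>\<eta>. Y = conormal S N \<xi> \<eta>"
proof -
  define W where "W = transpose (mat 1 + off_block S \<xi>) ** Y ** (mat 1 + off_block S \<xi>)"
  have Wsym: "W \<in> sym_mats" unfolding W_def by (rule sym_conj(1)[OF Y])
  have "sym_on N (entry W) = W"
  proof (rule sym_mats_eqI[OF _ Wsym])
    show "sym_on N (entry W) \<in> sym_mats" unfolding sym_on_def by (rule sym_of_sym)
    fix p :: "'n \<times> 'n" assume p: "p \<in> upper"
    then have "entry (sym_on N (entry W)) p = (if p \<in> N then entry W p else 0)"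
      unfolding sym_on_def by (rule entry_sym_of)
    moreover have "entry W p = 0" if "p \<notin> N"
      using z[of "fst p" "snd p"] p that by (simp add: entry_def W_def)
    ultimately show "entry (sym_on N (entry W)) p = entry W p" by simp
  qed
  then have "conormal S N \<xi> (entry W) = Y" unfolding conormal_def W_def
    by (simp add: conj_inverse[OF shear_inverse_transpose(2) shear_inverse(1)])
  then show ?thesis by metis
qed

text \<open>A proper subspace of the symmetric matrices has a nonzero symmetric \<open>Y\<close> orthogonal to it. For
  symmetric \<open>C\<close> supported on \<open>S \<times> S\<close> the matrix \<open>(1 + B) C (1 + B)\<^sup>T\<close> has its columns in the column
  span of \<open>param_mat S \<xi>\<close>, so \<open>Y\<close> is orthogonal to it. This kills the entries of
  \<open>(1 + B)\<^sup>T Y (1 + B)\<close> on \<open>S \<times> S\<close>.\<close>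
lemma non_transversal_conormal:
  fixes L :: "(real ^ 'n::finite ^ 'n) set"
  assumes nd: "nondegenerate_on S \<xi>" and L: "subspace L" "L \<subseteq> sym_mats"
    and nt: "\<not> Z_transversal (param_mat S \<xi>) L"
  shows "\<exists>\<eta>. conormal S (upper - S \<times> S) \<xi> \<eta> \<noteq> 0 \<and> (\<forall>x\<in>L. conormal S (upper - S \<times> S) \<xi> \<eta> \<bullet> x = 0)"
proof -
  let ?Z = "Zbar_of (param_mat S \<xi>)" and ?G = "mat 1 + off_block S \<xi>"
  have Z: "subspace ?Z"
  proof -
    have sub: "span (columns M) \<subseteq> span T \<longleftrightarrow> (\<forall>i. column i M \<in> span T)" for M :: "real ^ 'n ^ 'n" and T
    proof -
      have "span (columns M) \<subseteq> span T \<longleftrightarrow> columns M \<subseteq> span T"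
        using span_minimal[OF _ subspace_span, of "columns M" T] span_superset[of "columns M"] by blast
      then show ?thesis unfolding columns_def by auto
    qed
    have "column i (A + B) = column i A + column i B" "column i (c *\<^sub>R A) = c *\<^sub>R column i A" "column i (0 :: real ^ 'n ^ 'n) = 0" for i c and A B :: "real ^ 'n ^ 'n"
      by (simp_all add: column_def vec_eq_iff)
    then show ?thesis using subspace_sym_mats unfolding subspace_def Zbar_of_def sub
      by (simp add: span_add span_scale span_zero) blast
  qed
  define W where "W = {A + B | A B. A \<in> L \<and> B \<in> ?Z}"
  have W: "subspace W" unfolding W_def by (rule subspace_sums[OF L(1) Z])
  have "W \<subseteq> sym_mats"
    unfolding W_def Zbar_of_def using L(2) subspace_sym_mats by (auto intro: subspace_add)
  moreover have "W \<noteq> sym_mats" using nt unfolding Z_transversal_def W_def .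
  moreover have "span W = W" "span (sym_mats :: (real ^ 'n ^ 'n) set) = sym_mats"
    using W subspace_sym_mats by (simp_all add: span_eq_iff)
  ultimately have "span W \<subset> span sym_mats" by (simp only: psubset_eq simp_thms)
  then obtain Y where Y: "Y \<noteq> 0" "Y \<in> span sym_mats" "\<And>y. y \<in> span W \<Longrightarrow> orthogonal Y y"
    using orthogonal_to_subspace_exists_gen by blast
  have Ysym: "Y \<in> sym_mats" using Y(2) span_eq_iff[THEN iffD2, OF subspace_sym_mats] by metis
  have YL: "Y \<bullet> x = 0" if "x \<in> L" for x
  proof -
    have "x + 0 \<in> W" unfolding W_def using that subspace_0[OF Z] by blast
    then show ?thesis using Y(3) span_base unfolding orthogonal_def by fastforce
  qed
  have YZ: "Y \<bullet> x = 0" if "x \<in> ?Z" for x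
  proof -
    have "0 + x \<in> W" unfolding W_def using that subspace_0[OF L(1)] by blast
    then show ?thesis using Y(3) span_base unfolding orthogonal_def by fastforce
  qed
  have "(transpose ?G ** Y ** ?G) $ u $ v = 0" if uv: "u \<in> S" "v \<in> S" for u v
  proof -
    define C :: "real ^ 'n ^ 'n" where "C = axis u (axis v 1) + axis v (axis u 1)"
    have Csym: "C \<in> sym_mats" unfolding C_def sym_mats_entry by (auto simp: axis_def)
    have "C *v z \<in> supported S" for z
      using uv unfolding C_def supported_def matrix_vector_mult_def by (auto simp: axis_def)
    note C = this
    have "?G ** C ** transpose ?G \<in> ?Z"
    proof -
      have "(?G ** C ** transpose ?G) *v x \<in> span (columns (param_mat S \<xi>))" for x
      proof -
        obtain z where z: "C *v (transpose ?G *v x) = diag_block S \<xi> *v z"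
          using C diag_block_range[OF nd] by (metis imageE)
        have "(?G ** C ** transpose ?G) *v x = ?G *v (diag_block S \<xi> *v z)"
          by (simp only: z[symmetric] matrix_vector_mul_assoc matrix_mul_assoc)
        also have "\<dots> = param_mat S \<xi> *v (transpose (mat 1 - off_block S \<xi>) *v z)"
          unfolding param_mat_def
          by (simp only: matrix_vector_mul_assoc matrix_mul_assoc[symmetric] shear_inverse_transpose matrix_mul_rid)
        finally show ?thesis using matrix_vector_mult_in_columnspace by metis
      qed
      then have "columns (?G ** C ** transpose ?G) \<subseteq> span (columns (param_mat S \<xi>))"
        unfolding columns_def by (auto simp: matrix_vector_mult_basis[symmetric])
      then have "span (columns (?G ** C ** transpose ?G)) \<subseteq> span (columns (param_mat S \<xi>))"
        by (rule span_minimal) simp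
      then show ?thesis unfolding Zbar_of_def using sym_conj(2)[OF Csym] by blast
    qed
    then have "0 = (transpose ?G ** Y ** ?G) \<bullet> C" using YZ inner_matrix_conj[of Y ?G C "transpose ?G"] by simp
    also have "\<dots> = (transpose ?G ** Y ** ?G) $ u $ v + (transpose ?G ** Y ** ?G) $ v $ u"
      unfolding C_def by (simp add: inner_add_right inner_axis)
    also have "\<dots> = 2 * (transpose ?G ** Y ** ?G) $ u $ v"
      using sym_conj(1)[OF Ysym, of ?G] unfolding sym_mats_entry by simp
    finally show ?thesis by simp
  qed
  then obtain \<eta> where "Y = conormal S (upper - S \<times> S) \<xi> \<eta>"
    using conormal_of_conj[OF Ysym, of "upper - S \<times> S" S \<xi>] by auto
  then show ?thesis using Y(1) YL by metis
qed

text \<open>The differential of \<open>param_mat S\<close> at \<open>\<xi>\<close> in direction \<open>\<delta>\<close>, by the product rule.\<close>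
definition param_deriv :: "'n::finite set \<Rightarrow> ('n \<times> 'n \<Rightarrow> real) \<Rightarrow> ('n \<times> 'n \<Rightarrow> real) \<Rightarrow> real ^ 'n ^ 'n" where
  "param_deriv S \<xi> \<delta> = off_block S \<delta> ** diag_block S \<xi> ** transpose (mat 1 + off_block S \<xi>)
     + (mat 1 + off_block S \<xi>) ** diag_block S \<delta> ** transpose (mat 1 + off_block S \<xi>)
     + (mat 1 + off_block S \<xi>) ** diag_block S \<xi> ** transpose (off_block S \<delta>)"

text \<open>Let \<open>W = (1 + B)\<^sup>T Y (1 + B)\<close>. Varying \<open>A\<close> kills the entries of \<open>W\<close> on \<open>S \<times> S\<close>. Varying \<open>B\<close> kills
  the entries of \<open>Y (1 + B) A\<close> on \<open>(-S) \<times> S\<close>; these are the entries of \<open>W A\<close>, because \<open>1 + B\<close> and the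
  identity have the same columns outside \<open>S\<close>, and \<open>A\<close> is invertible on \<open>S\<close>.\<close>
lemma critical_conormal:
  fixes Y :: "real ^ 'n::finite ^ 'n"
  assumes nd: "nondegenerate_on S \<xi>" and Y: "Y \<in> sym_mats"
    and crit: "\<And>c. Y \<bullet> param_deriv S \<xi> (\<lambda>p. if p = c then 1 else 0) = 0"
  shows "\<exists>\<eta>. Y = conormal S (upper \<inter> (-S) \<times> (-S)) \<xi> \<eta>"
proof (rule conormal_of_conj[OF Y])
  let ?G = "mat 1 + off_block S \<xi>" and ?A = "diag_block S \<xi>"
  define W where "W = transpose ?G ** Y ** ?G"
  have Wsym: "W \<in> sym_mats" unfolding W_def by (rule sym_conj(1)[OF Y])
  have SS: "W $ u $ v = 0" if uv: "u \<in> S" "v \<in> S" "(u, v) \<in> upper" for u v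
  proof -
    define \<delta> :: "'n \<times> 'n \<Rightarrow> real" where "\<delta> = (\<lambda>p. if p = (u, v) then 1 else 0)"
    have "off_block S \<delta> = 0" unfolding off_block_def \<delta>_def using uv by (auto simp: vec_eq_iff)
    then have "param_deriv S \<xi> \<delta> = ?G ** diag_block S \<delta> ** transpose ?G" unfolding param_deriv_def by (simp add: transpose_zero)
    then have "W \<bullet> diag_block S \<delta> = 0"
      using crit[of "(u, v)"] unfolding \<delta>_def[symmetric] W_def by (simp add: inner_matrix_conj)
    then have "0 = (\<Sum>p\<in>upper. dual_coef W p * entry (diag_block S \<delta>) p)"
      using inner_sym[OF Wsym diag_block_sym] by simp
    also have "\<dots> = (\<Sum>p\<in>upper. if p = (u, v) then dual_coef W p else 0)"
      by (rule sum.cong) (use uv in \<open>auto simp: entry_def diag_block_def \<delta>_def fold_up_id\<close>)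
    also have "\<dots> = dual_coef W (u, v)" using uv by (simp add: sum.delta)
    finally show ?thesis using dual_coef_eq_0_iff[of W "(u, v)"] by (simp add: entry_def)
  qed
  have YGA: "(Y ** ?G ** ?A) $ u $ v = 0" if uv: "u \<notin> S" "v \<in> S" for u v
  proof -
    define \<delta> :: "'n \<times> 'n \<Rightarrow> real" where "\<delta> = (\<lambda>p. if p = (u, v) then 1 else 0)"
    have "fold_up (i, j) \<noteq> (u, v)" if "i \<in> S" "j \<in> S" for i j
      using fold_up_cases[of i j] that uv by auto
    then have "diag_block S \<delta> = 0" unfolding diag_block_def \<delta>_def by (auto simp: vec_eq_iff)
    then have d: "param_deriv S \<xi> \<delta> = off_block S \<delta> ** ?A ** transpose ?G + ?G ** ?A ** transpose (off_block S \<delta>)"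
      unfolding param_deriv_def by simp
    define M where "M = off_block S \<delta> ** ?A ** transpose ?G"
    have At: "transpose ?A = ?A" using diag_block_sym[of S \<xi>] unfolding sym_mats_def by simp
    have "?G ** ?A ** transpose (off_block S \<delta>) = transpose M"
      unfolding M_def by (simp add: matrix_transpose_mul matrix_mul_assoc At)
    moreover have "Y \<bullet> transpose M = Y \<bullet> M"
    proof -
      have "Y \<bullet> transpose M = trace (Y ** transpose M)" using Y by (simp add: inner_eq_trace sym_mats_def)
      also have "\<dots> = trace (transpose M ** Y)" by (rule trace_mul_sym)
      also have "\<dots> = Y \<bullet> M" by (simp add: inner_eq_trace[symmetric] inner_commute)
      finally show ?thesis .
    qed
    ultimately have "Y \<bullet> M = 0"
      using crit[of "(u, v)"] unfolding \<delta>_def[symmetric] d M_def[symmetric] by (simp add: inner_add_right)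
    moreover have "M = mat 1 ** off_block S \<delta> ** (?A ** transpose ?G)" unfolding M_def by (simp add: matrix_mul_assoc)
    ultimately have "(Y ** (?G ** ?A)) \<bullet> off_block S \<delta> = 0"
      by (simp only: inner_matrix_conj) (simp add: matrix_transpose_mul At)
    moreover have "off_block S \<delta> = axis u (axis v 1)"
      unfolding off_block_def \<delta>_def using uv by (auto simp: vec_eq_iff axis_def)
    ultimately show ?thesis by (simp add: inner_axis matrix_mul_assoc)
  qed
  have mixed: "W $ u $ v = 0" if uv: "u \<notin> S" "v \<in> S" for u v
  proof -
    have e: "Y ** ?G = transpose (mat 1 - off_block S \<xi>) ** W"
      unfolding W_def by (simp add: matrix_mul_assoc shear_inverse_transpose)
    have YG: "(Y ** ?G) $ u $ w = W $ u $ w" for w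
    proof -
      have "(transpose (mat 1 - off_block S \<xi>) ** W) $ u $ w = (\<Sum>k\<in>UNIV. if k = u then W $ k $ w else 0)"
        unfolding matrix_matrix_mult_def transpose_def vec_lambda_beta
        by (rule sum.cong) (auto simp: mat_def off_block_def uv)
      also have "\<dots> = W $ u $ w" by (subst sum.delta) auto
      finally show ?thesis unfolding e .
    qed
    define z :: "real ^ 'n" where "z = (\<chi> w. if w \<in> S then W $ u $ w else 0)"
    have "(?A *v z) $ k = 0" for k
    proof (cases "k \<in> S")
      case True
      have "(?A *v z) $ k = (\<Sum>w\<in>UNIV. W $ u $ w * ?A $ w $ k)"
        unfolding matrix_vector_mult_def z_def
        by (auto intro!: sum.cong simp: diag_block_def fold_up_swap)
      also have "\<dots> = (Y ** ?G ** ?A) $ u $ k" unfolding YG[symmetric] matrix_matrix_mult_def[of "Y ** ?G"] by simp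
      finally show ?thesis using YGA[OF uv(1) True] by simp
    next
      case False
      then show ?thesis using diag_block_mult_supported[of S \<xi> z] unfolding supported_def by blast
    qed
    then have "?A *v z = 0" by (simp add: vec_eq_iff)
    moreover have "z \<in> supported S" unfolding supported_def z_def by simp
    ultimately have "z = 0" using nd unfolding nondegenerate_on_def by blast
    then have "z $ v = 0" by simp
    then show ?thesis using uv unfolding z_def by simp
  qed
  fix u v assume uv: "(u, v) \<in> upper" "(u, v) \<notin> upper \<inter> (-S) \<times> (-S)"
  then consider "u \<in> S" "v \<in> S" | "u \<notin> S" "v \<in> S" | "u \<in> S" "v \<notin> S" by auto
  then have "W $ u $ v = 0"
  proof cases
    case 3
    then show ?thesis using mixed[of v u] Wsym unfolding sym_mats_entry by simp
  qed (use SS mixed uv in auto)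
  then show "(transpose ?G ** Y ** ?G) $ u $ v = 0" unfolding W_def .
qed

section \<open>Solutions near a regular point\<close>

definition coords :: "'n::finite set \<Rightarrow> ('n \<times> 'n) set" where
  "coords S = (upper \<inter> S \<times> S) \<union> ((- S) \<times> S)"

text \<open>The positions in \<open>S \<times> S\<close> on or above the diagonal and their transposes cover \<open>S \<times> S\<close> and overlap in
  the diagonal.\<close>
lemma card_upper_block: "2 * card (upper \<inter> S \<times> S) = card S * (card S + 1)"
proof -
  let ?U = "upper \<inter> S \<times> S"
  have Un: "?U \<union> prod.swap ` ?U = S \<times> S"
  proof -
    have "p \<in> ?U \<union> prod.swap ` ?U" if "p \<in> S \<times> S" for p
      using that unfolding upper_def by (cases p) (force simp: image_iff)
    then show ?thesis by auto
  qed
  have "?U \<inter> prod.swap ` ?U = (\<lambda>i. (i, i)) ` S"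
    unfolding upper_def by auto
  then have "card (?U \<inter> prod.swap ` ?U) = card S" by (simp add: card_image inj_on_def)
  moreover have "card (prod.swap ` ?U) = card ?U" by (intro card_image inj_on_subset[OF inj_swap]) auto
  ultimately have "2 * card ?U = card (S \<times> S) + card S"
    using card_Un_Int[of ?U "prod.swap ` ?U"] Un by simp
  then show ?thesis by (simp add: card_cartesian_product)
qed

lemma card_upper: "2 * card (upper :: ('n::finite \<times> 'n) set) = CARD('n) * (CARD('n) + 1)"
  using card_upper_block[of "UNIV :: 'n set"] by simp

lemma card_coords: "card (coords S) = card (upper \<inter> S \<times> S) + card (- S) * card S"
  unfolding coords_def by (subst card_Un_disjoint) (auto simp: card_cartesian_product)

lemma blocks_cong:
  assumes "\<And>s. s \<in> coords S \<Longrightarrow> \<xi> s = \<xi>' s"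
  shows "diag_block S \<xi> = diag_block S \<xi>'" "off_block S \<xi> = off_block S \<xi>'"
proof -
  have "fold_up (u, v) \<in> coords S" if "u \<in> S" "v \<in> S" for u v
    using that fold_up_upper[of "(u, v)"] fold_up_cases[of u v] unfolding coords_def by auto
  then show "diag_block S \<xi> = diag_block S \<xi>'"
    unfolding diag_block_def by (auto simp: vec_eq_iff assms)
  show "off_block S \<xi> = off_block S \<xi>'"
    unfolding off_block_def by (auto simp: vec_eq_iff assms coords_def)
qed

lemma param_mat_cong: "(\<And>s. s \<in> coords S \<Longrightarrow> \<xi> s = \<xi>' s) \<Longrightarrow> param_mat S \<xi> = param_mat S \<xi>'"
  unfolding param_mat_def using blocks_cong[of S \<xi> \<xi>'] by simp

lemma positive_on_cong: "(\<And>s. s \<in> coords S \<Longrightarrow> \<xi> s = \<xi>' s) \<Longrightarrow> positive_on S \<xi> = positive_on S \<xi>'"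
  unfolding positive_on_def using blocks_cong[of S \<xi> \<xi>'] by simp

lemma bounded_linear_diag_block: "bounded_linear (\<lambda>x. diag_block S (($) x))"
  by (rule linear_conv_bounded_linear[THEN iffD1], rule linearI) (auto simp: diag_block_def vec_eq_iff)

lemma bounded_linear_off_block: "bounded_linear (\<lambda>x. off_block S (($) x))"
  by (rule linear_conv_bounded_linear[THEN iffD1], rule linearI) (auto simp: off_block_def vec_eq_iff)

lemma bounded_linear_transpose: "bounded_linear (transpose :: real ^ 'n ^ 'm \<Rightarrow> _)"
  by (rule linear_conv_bounded_linear[THEN iffD1], rule linearI) (auto simp: transpose_def vec_eq_iff)

lemma bounded_bilinear_matrix_mult: "bounded_bilinear ((**) :: real ^ 'n ^ 'm \<Rightarrow> real ^ 'l ^ 'n \<Rightarrow> _)"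
  unfolding bilinear_conv_bounded_bilinear[symmetric] bilinear_def
  by (auto intro!: linearI simp: matrix_mul_add_left matrix_add_ldistrib vec_eq_iff matrix_matrix_mult_def
      sum_distrib_left mult_ac distrib_left sum.distrib)

lemma linear_param_deriv: "linear (\<lambda>\<delta>. param_deriv S \<xi> (($) \<delta>))"
proof -
  note l = linear_conv_bounded_linear[THEN iffD2]
  note d = l[OF bounded_linear_diag_block[of S]] and o = l[OF bounded_linear_off_block[of S]]
  note t = l[OF bounded_linear_transpose]
  have m: "c *\<^sub>R A ** B = c *\<^sub>R (A ** B)" "A ** c *\<^sub>R B = c *\<^sub>R (A ** B)" for c and A B :: "real ^ 'a ^ 'a"
    by (simp_all add: vec_eq_iff matrix_matrix_mult_def sum_distrib_left mult_ac)
  show ?thesis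
    unfolding param_deriv_def
    by (rule linearI) (simp_all only: linear_add[OF d] linear_add[OF o] linear_scale[OF d] linear_scale[OF o]
        linear_add[OF t] linear_scale[OF t] m matrix_mul_add_left matrix_add_ldistrib scaleR_add_right add_ac)
qed

lemma has_derivative_param_mat: "((\<lambda>x. param_mat S (($) x)) has_derivative (\<lambda>\<delta>. param_deriv S (($) x) (($) \<delta>))) (at x)"
proof -
  note D = bounded_linear_imp_has_derivative[OF bounded_linear_diag_block[of S]]
  have O: "((\<lambda>x. mat 1 + off_block S (($) x)) has_derivative (\<lambda>\<delta>. off_block S (($) \<delta>))) (at x)"
    using has_derivative_add[OF has_derivative_const bounded_linear_imp_has_derivative[OF bounded_linear_off_block[of S]]]
    by simp
  note T = bounded_linear.has_derivative[OF bounded_linear_transpose O]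
  note P = bounded_bilinear.FDERIV[OF bounded_bilinear_matrix_mult bounded_bilinear.FDERIV[OF bounded_bilinear_matrix_mult O D] T]
  show ?thesis unfolding param_mat_def param_deriv_def
    by (rule has_derivative_eq_rhs[OF P]) (auto simp: matrix_mul_add_left add_ac)
qed

lemma param_deriv_sym: "param_deriv S \<xi> \<delta> \<in> sym_mats"
proof -
  have "transpose (A + B) = transpose A + transpose B" for A B :: "real ^ 'a ^ 'a"
    by (simp add: transpose_def vec_eq_iff)
  moreover have "transpose (diag_block S \<zeta>) = diag_block S \<zeta>" for \<zeta>
    using diag_block_sym unfolding sym_mats_def by blast
  ultimately show ?thesis unfolding sym_mats_def param_deriv_def
    by (simp add: matrix_transpose_mul matrix_mul_assoc transpose_mat add_ac)
qed

definition chart_eq :: "('m::finite \<Rightarrow> 'n::finite \<times> 'n) \<Rightarrow> (('n \<times> 'n) \<times> 'm \<Rightarrow> real) \<Rightarrow> 'n \<times> 'n \<Rightarrow> real ^ 'n ^ 'n \<Rightarrow> real" where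
  "chart_eq I a j x = entry x j - (\<Sum>l\<in>UNIV. a (j, l) * entry x (I l))"

lemma chart_space_iff: "x \<in> chart_space I a \<longleftrightarrow> x \<in> sym_mats \<and> (\<forall>j\<in>upper - range I. chart_eq I a j x = 0)"
  unfolding chart_space_def chart_eq_def by auto

lemma bounded_linear_chart_eq: "bounded_linear (chart_eq I a j)"
  by (rule linear_conv_bounded_linear[THEN iffD1], rule linearI)
     (simp_all add: chart_eq_def entry_simps algebra_simps sum.distrib sum_distrib_left)

text \<open>A combination of the equations of a chart space is the inner product with a symmetric matrix. It is
  nonzero because its coefficients at the dependent positions are the given \<open>b\<close>.\<close>
lemma chart_eq_combination:
  fixes I :: "'m::finite \<Rightarrow> 'n::finite \<times> 'n"
  assumes I: "inj I" "range I \<subseteq> upper" and b: "j0 \<in> upper - range I" "b j0 \<noteq> 0"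
  obtains Y where "Y \<in> sym_mats" "Y \<noteq> 0"
    "\<And>x. x \<in> sym_mats \<Longrightarrow> Y \<bullet> x = (\<Sum>j\<in>upper - range I. b j * chart_eq I a j x)"
proof -
  let ?J = "upper - range I"
  define w :: "'n \<times> 'n \<Rightarrow> real" where "w = (\<lambda>p. if fst p = snd p then 1 else 2)"
  define Y where "Y = sym_of (\<lambda>p. (if p \<in> range I then - (\<Sum>j\<in>?J. b j * a (j, inv I p)) else b p) / w p)"
  have w: "w p \<noteq> 0" for p unfolding w_def by simp
  have cY: "dual_coef Y p = (if p \<in> range I then - (\<Sum>j\<in>?J. b j * a (j, inv I p)) else b p)" if "p \<in> upper" for p
    using w[of p] unfolding dual_coef_def Y_def w_def[symmetric] entry_sym_of[OF that] by (simp add: w_def)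
  have Ysym: "Y \<in> sym_mats" unfolding Y_def by (rule sym_of_sym)
  have "Y \<bullet> x = (\<Sum>j\<in>?J. b j * chart_eq I a j x)" if x: "x \<in> sym_mats" for x
  proof -
    have "Y \<bullet> x = (\<Sum>j\<in>?J. dual_coef Y j * entry x j) + (\<Sum>l\<in>UNIV. dual_coef Y (I l) * entry x (I l))"
      unfolding inner_sym[OF Ysym x] by (rule sum_upper_split[OF I])
    also have "(\<Sum>j\<in>?J. dual_coef Y j * entry x j) = (\<Sum>j\<in>?J. b j * entry x j)"
      by (rule sum.cong) (auto simp: cY)
    also have "(\<Sum>l\<in>UNIV. dual_coef Y (I l) * entry x (I l)) = (\<Sum>l\<in>UNIV. - (\<Sum>j\<in>?J. b j * (a (j, l) * entry x (I l))))"
      by (rule sum.cong) (use I in \<open>auto simp: cY subsetD sum_distrib_right mult.assoc\<close>)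
    also have "\<dots> = - (\<Sum>j\<in>?J. b j * (\<Sum>l\<in>UNIV. a (j, l) * entry x (I l)))"
      unfolding sum_negf by (subst sum.swap) (simp add: sum_distrib_left)
    finally show ?thesis unfolding chart_eq_def by (simp add: right_diff_distrib sum_subtractf)
  qed
  moreover have "Y \<noteq> 0" using cY[of j0] b by (auto simp: dual_coef_def entry_0)
  ultimately show ?thesis using that Ysym by blast
qed

text \<open>The hypothesis \<open>regular\<close> says that the differentials of the equations of \<open>L\<close> are independent at
  \<open>\<xi>0\<close>. So there is a set \<open>K'\<close> of as many coordinates as equations along which these differentials
  form an invertible matrix. The map \<open>f\<close> that replaces the coordinates in \<open>K'\<close> by the values of the
  equations has an invertible differential, and it is open at \<open>\<xi>0\<close>. Preimages of points whose
  coordinates in \<open>K'\<close> are 0 are solutions, with the coordinates in \<open>K = coords S - K'\<close> prescribed.\<close>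
lemma solutions_over_open_box:
  fixes I :: "'m::finite \<Rightarrow> 'n::finite \<times> 'n"
  assumes I: "inj I" "range I \<subseteq> upper"
    and pos: "positive_on S \<xi>0" and L: "param_mat S \<xi>0 \<in> chart_space I a"
    and regular: "\<And>Y. Y \<in> sym_mats \<Longrightarrow> Y \<noteq> 0 \<Longrightarrow> (\<And>x. x \<in> chart_space I a \<Longrightarrow> Y \<bullet> x = 0) \<Longrightarrow>
        \<exists>c. Y \<bullet> param_deriv S \<xi>0 (\<lambda>p. if p = c then 1 else 0) \<noteq> 0"
  shows "\<exists>K. card K + card (upper - range I) = card (coords S) \<and>
    (\<exists>t0 e. e > 0 \<and> (\<forall>t. (\<forall>c\<in>K. \<bar>t c - t0 c\<bar> < e) \<longrightarrow>
      (\<exists>\<xi>. (\<forall>c\<in>K. \<xi> c = t c) \<and> (\<forall>s. s \<notin> coords S \<longrightarrow> \<xi> s = 1) \<and>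
        positive_on S \<xi> \<and> param_mat S \<xi> \<in> chart_space I a)))"
proof -
  define J where "J = upper - range I"
  define x0 :: "real ^ ('n \<times> 'n)" where "x0 = (\<chi> s. \<xi>0 s)"
  have x0: "($) x0 = \<xi>0" unfolding x0_def by auto
  define q where "q = (\<lambda>x j. chart_eq I a j (param_mat S (($) x)))"
  define dq where "dq = (\<lambda>x \<delta> j. chart_eq I a j (param_deriv S (($) x) (($) (\<delta> :: real ^ ('n \<times> 'n)))))"
  have der_q: "((\<lambda>x. q x j) has_derivative (\<lambda>\<delta>. dq x \<delta> j)) (at x)" for x j
    unfolding q_def dq_def by (rule bounded_linear.has_derivative[OF bounded_linear_chart_eq has_derivative_param_mat])
  have lin_dq: "linear (\<lambda>\<delta>. dq x \<delta> j)" for x j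
    unfolding dq_def
    using linear_compose[OF linear_param_deriv linear_conv_bounded_linear[THEN iffD2, OF bounded_linear_chart_eq]]
    by (simp add: o_def)
  define g where "g = (\<lambda>\<delta>. (\<chi> j. if j \<in> J then dq x0 \<delta> j else 0) :: real ^ ('n \<times> 'n))"
  have lin_g: "linear g"
    by (rule linearI) (auto simp: g_def vec_eq_iff linear_add[OF lin_dq] linear_scale[OF lin_dq])
  define E where "E = (\<lambda>c. axis c 1 :: real ^ ('n \<times> 'n))"
  have E: "($) (E c) = (\<lambda>p. if p = c then 1 else 0)" for c unfolding E_def axis_def by auto
  have gE0: "g (E c) = 0" if "c \<notin> coords S" for c
  proof -
    have "E c $ s = 0 $ s" if "s \<in> coords S" for s
      using that \<open>c \<notin> coords S\<close> unfolding E by auto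
    then have d: "param_deriv S (($) x0) (($) (E c)) = param_deriv S (($) x0) (($) 0)"
      unfolding param_deriv_def using blocks_cong[of S "($) (E c)" "($) 0"] by simp
    have "g (E c) = g 0" unfolding g_def dq_def d ..
    then show ?thesis using linear_0[OF lin_g] by simp
  qed
  have gsupp: "g x \<in> supported J" for x unfolding g_def supported_def by simp
  \<comment> \<open>A vector orthogonal to the span gives a combination of the equations critical at \<open>\<xi>0\<close>.\<close>
  have "supported J \<subseteq> span ((\<lambda>c. g (E c)) ` coords S)"
  proof (rule ccontr)
    assume n: "\<not> ?thesis"
    have "span ((\<lambda>c. g (E c)) ` coords S) \<subseteq> supported J"
      using gsupp by (intro span_minimal subspace_supported) auto
    with n have "span ((\<lambda>c. g (E c)) ` coords S) \<subset> span (supported J)"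
      using span_superset[of "supported J"] by (metis psubsetI order_trans subset_antisym)
    then obtain b where b: "b \<noteq> 0" "b \<in> span (supported J)"
        "\<And>y. y \<in> span ((\<lambda>c. g (E c)) ` coords S) \<Longrightarrow> orthogonal b y"
      using orthogonal_to_subspace_exists_gen by blast
    have bJ: "b \<in> supported J" using b(2) span_eq_iff[THEN iffD2, OF subspace_supported] by metis
    then obtain j0 where j0: "j0 \<in> J" "b $ j0 \<noteq> 0" using b(1) unfolding supported_def by (auto simp: vec_eq_iff)
    obtain Y where Y: "Y \<in> sym_mats" "Y \<noteq> 0" "\<And>x. x \<in> sym_mats \<Longrightarrow> Y \<bullet> x = (\<Sum>j\<in>J. b $ j * chart_eq I a j x)"
      using chart_eq_combination[OF I, of j0 "($) b" a] j0 unfolding J_def by blast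
    have "Y \<bullet> x = 0" if "x \<in> chart_space I a" for x
      using that Y(3)[of x] unfolding chart_space_iff J_def by simp
    then obtain c where c: "Y \<bullet> param_deriv S \<xi>0 (\<lambda>p. if p = c then 1 else 0) \<noteq> 0"
      using regular[OF Y(1,2)] by blast
    have "Y \<bullet> param_deriv S \<xi>0 (\<lambda>p. if p = c then 1 else 0) = (\<Sum>j\<in>J. b $ j * g (E c) $ j)"
      unfolding Y(3)[OF param_deriv_sym] by (rule sum.cong) (auto simp: g_def dq_def x0 E)
    also have "\<dots> = (\<Sum>j\<in>UNIV. b $ j * g (E c) $ j)"
      by (rule sum.mono_neutral_left) (use gsupp[of "E c"] in \<open>auto simp: supported_def\<close>)
    also have "\<dots> = b \<bullet> g (E c)" by (simp add: inner_vec_def)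
    also have "\<dots> = 0"
    proof (cases "c \<in> coords S")
      case True
      then show ?thesis using b(3)[OF span_base] unfolding orthogonal_def by blast
    qed (simp add: gE0)
    finally show False using c by simp
  qed
  moreover obtain Bs where Bs: "Bs \<subseteq> (\<lambda>c. g (E c)) ` coords S" "independent Bs" "(\<lambda>c. g (E c)) ` coords S \<subseteq> span Bs"
    using maximal_independent_subset by blast
  ultimately have "supported J \<subseteq> span Bs" using span_minimal[OF Bs(3) subspace_span] by blast
  moreover have "Bs \<subseteq> supported J" using Bs(1) gsupp by blast
  ultimately have cardBs: "card Bs = card J"
    using basis_card_eq_dim[of Bs "supported J"] Bs(2) dim_supported[of J] by simp
  obtain K' where K': "K' \<subseteq> coords S" "inj_on (\<lambda>c. g (E c)) K'" "Bs = (\<lambda>c. g (E c)) ` K'"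
    using Bs(1) unfolding subset_image_inj by blast
  have cardK': "card K' = card J" using K' cardBs by (simp add: card_image)
  define K where "K = coords S - K'"
  have cardK: "card K + card J = card (coords S)"
    using K'(1) cardK' card_mono[OF _ K'(1)] unfolding K_def by (simp add: card_Diff_subset finite_subset)
  obtain \<gamma> where \<gamma>: "bij_betw \<gamma> K' J" using finite_same_card_bij[OF _ _ cardK'] by auto
  define f where "f = (\<lambda>x. (\<chi> c. if c \<in> K' then q x (\<gamma> c) else x $ c) :: real ^ ('n \<times> 'n))"
  define f' where "f' = (\<lambda>x \<delta>. (\<chi> c. if c \<in> K' then dq x \<delta> (\<gamma> c) else \<delta> $ c) :: real ^ ('n \<times> 'n))"
  have der: "(f has_derivative f' x) (at x)" for x
  proof -
    have "((\<lambda>x. f x \<bullet> axis c 1) has_derivative (\<lambda>\<delta>. f' x \<delta> \<bullet> axis c 1)) (at x)" for c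
      using der_q by (cases "c \<in> K'") (auto simp: f_def f'_def inner_axis intro!: derivative_eq_intros bounded_linear.has_derivative[OF bounded_linear_vec_nth])
    then show ?thesis by (subst has_derivative_componentwise_within) (auto simp: Basis_vec_def)
  qed
  have lin_f': "linear (f' x0)" using der[of x0] has_derivative_linear by blast
  have "inj (f' x0)"
    unfolding linear_injective_0[OF lin_f']
  proof (intro allI impI)
    fix \<delta> assume z: "f' x0 \<delta> = 0"
    have out: "\<delta> $ c = 0" if "c \<notin> K'" for c using arg_cong[OF z, of "\<lambda>v. v $ c"] that by (simp add: f'_def)
    have "dq x0 \<delta> j = 0" if "j \<in> J" for j
    proof -
      obtain c where c: "c \<in> K'" "\<gamma> c = j" using \<gamma> \<open>j \<in> J\<close> unfolding bij_betw_def by blast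
      then show ?thesis using arg_cong[OF z, of "\<lambda>v. v $ c"] by (simp add: f'_def)
    qed
    then have g0: "g \<delta> = 0" unfolding g_def by (simp add: vec_eq_iff)
    have "\<delta> = (\<Sum>c\<in>UNIV. \<delta> $ c *\<^sub>R E c)" unfolding E_def
      using basis_expansion[of \<delta>] by (simp add: scalar_mult_eq_scaleR)
    also have "\<dots> = (\<Sum>c\<in>K'. \<delta> $ c *\<^sub>R E c)"
      by (rule sum.mono_neutral_right) (auto simp: out)
    finally have "g \<delta> = g (\<Sum>c\<in>K'. \<delta> $ c *\<^sub>R E c)" by simp
    then have s0: "(\<Sum>c\<in>K'. \<delta> $ c *\<^sub>R g (E c)) = 0"
      using g0 by (simp add: linear_sum[OF lin_g] linear_scale[OF lin_g])
    have "(\<Sum>v\<in>Bs. \<delta> $ (inv_into K' (\<lambda>c. g (E c)) v) *\<^sub>R v) = (\<Sum>c\<in>K'. \<delta> $ c *\<^sub>R g (E c))"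
      unfolding K'(3) sum.reindex[OF K'(2)] by (rule sum.cong) (auto simp: inv_into_f_f[OF K'(2)])
    then have "\<forall>v\<in>Bs. \<delta> $ (inv_into K' (\<lambda>c. g (E c)) v) = 0"
      using Bs(2) K'(3) s0 by (intro ballI independentD[of Bs Bs]) auto
    then have "\<delta> $ c = 0" if "c \<in> K'" for c
      using that unfolding K'(3) by (auto simp: inv_into_f_f[OF K'(2)])
    then show "\<delta> = 0" using out by (auto simp: vec_eq_iff)
  qed
  then have "surj (f' x0)" using linear_injective_imp_surjective[OF lin_f'] by blast
  then obtain g' where g': "linear g'" "f' x0 \<circ> g' = id"
    using linear_surjective_right_inverse[OF lin_f'] by blast
  obtain \<epsilon> where \<epsilon>: "\<epsilon> > 0" "\<And>\<xi>'. (\<And>p. \<bar>\<xi>' p - \<xi>0 p\<bar> < \<epsilon>) \<Longrightarrow> positive_on S \<xi>'"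
    using positive_on_open[OF pos] by blast
  have "f x0 \<in> interior (f ` ball x0 \<epsilon>)"
  proof (rule sussmann_open_mapping[of UNIV f x0 "f' x0" g' "ball x0 \<epsilon>"])
    show "continuous_on UNIV f"
      using der by (intro continuous_at_imp_continuous_on) (auto dest: has_derivative_continuous)
    show "bounded_linear g'" using g'(1) by (simp add: linear_conv_bounded_linear)
  qed (use der g'(2) \<epsilon>(1) in auto)
  then obtain \<rho> where \<rho>: "\<rho> > 0" "ball (f x0) \<rho> \<subseteq> f ` ball x0 \<epsilon>" unfolding mem_interior by blast
  \<comment> \<open>The norm is at most the sum of the absolute values of the coordinates.\<close>
  define e where "e = \<rho> / (real CARD('n \<times> 'n) + 1)"
  have e: "e > 0" unfolding e_def using \<rho>(1) by (simp add: add_nonneg_pos)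
  have "\<exists>\<xi>. (\<forall>c\<in>K. \<xi> c = t c) \<and> (\<forall>s. s \<notin> coords S \<longrightarrow> \<xi> s = 1) \<and> positive_on S \<xi> \<and> param_mat S \<xi> \<in> chart_space I a"
    if t: "\<forall>c\<in>K. \<bar>t c - \<xi>0 c\<bar> < e" for t
  proof -
    define y :: "real ^ ('n \<times> 'n)" where "y = (\<chi> c. if c \<in> K then t c else f x0 $ c)"
    have comp: "\<bar>(y - f x0) $ c\<bar> \<le> e" for c
      using t e unfolding y_def f_def K_def by (auto simp: x0 less_imp_le)
    have "norm (y - f x0) \<le> (\<Sum>c\<in>UNIV. \<bar>(y - f x0) $ c\<bar>)" by (rule norm_le_l1_cart)
    also have "\<dots> \<le> (\<Sum>c\<in>(UNIV :: ('n \<times> 'n) set). e)" using comp by (rule sum_mono)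
    also have "\<dots> = real CARD('n \<times> 'n) * e" by simp
    also have "\<dots> < (real CARD('n \<times> 'n) + 1) * e" using e by simp
    also have "\<dots> = \<rho>" unfolding e_def by (simp add: add_nonneg_pos less_imp_neq[THEN not_sym])
    finally have "y \<in> ball (f x0) \<rho>" by (simp add: dist_norm norm_minus_commute)
    then obtain x where x: "x \<in> ball x0 \<epsilon>" "f x = y" using \<rho>(2) by auto
    have "positive_on S (($) x)"
    proof (rule \<epsilon>(2))
      fix p
      have "\<bar>(x - x0) $ p\<bar> \<le> norm (x - x0)" by (rule component_le_norm_cart)
      also have "\<dots> < \<epsilon>" using x(1) by (simp add: dist_norm norm_minus_commute)
      finally show "\<bar>x $ p - \<xi>0 p\<bar> < \<epsilon>" by (simp add: x0)
    qed
    moreover have "q x j = 0" if j: "j \<in> J" for j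
    proof -
      obtain c where c: "c \<in> K'" "\<gamma> c = j" using \<gamma> j unfolding bij_betw_def by blast
      have "q x0 j = 0" using L j unfolding q_def x0 chart_space_iff J_def by blast
      then have "y $ c = 0" unfolding y_def f_def K_def using c by simp
      then show ?thesis using c unfolding x(2)[symmetric] f_def by simp
    qed
    then have "param_mat S (($) x) \<in> chart_space I a"
      unfolding chart_space_iff q_def J_def using param_mat_sym by blast
    moreover have "x $ c = t c" if "c \<in> K" for c
    proof -
      have "f x $ c = t c" using that unfolding x(2) y_def by simp
      then show ?thesis using that unfolding f_def K_def by simp
    qed
    moreover define \<xi> where "\<xi> = (\<lambda>s. if s \<in> coords S then x $ s else 1)"
    ultimately show ?thesis
      using param_mat_cong[of S \<xi> "($) x"] positive_on_cong[of S \<xi> "($) x"]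
      by (intro exI[of _ \<xi>]) (auto simp: \<xi>_def K_def)
  qed
  then show ?thesis using cardK e unfolding J_def by blast
qed

section \<open>The exceptional subspaces\<close>

text \<open>Scaling the block \<open>A\<close> scales \<open>param_mat S \<xi>\<close> inside \<open>L\<close> and does not affect \<open>B\<close>, hence not the
  conormal matrices. This saves one parameter.\<close>
lemma has_conormal_normalize:
  assumes has_conormal: "has_conormal S N L \<xi>" and L: "subspace L"
  obtains s0 \<xi>' where "s0 \<in> coords S" "\<And>s. s \<notin> coords S - {s0} \<Longrightarrow> \<xi>' s = 1" "has_conormal S N L \<xi>'"
proof -
  let ?U = "upper \<inter> S \<times> S"
  have fU: "fold_up (u, v) \<in> ?U" if "u \<in> S" "v \<in> S" for u v
    using that fold_up_upper[of "(u, v)"] fold_up_cases[of u v] by auto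
  have param_nonzero: "param_mat S \<xi> \<noteq> 0" using has_conormal unfolding has_conormal_def by blast
  have "\<exists>s0\<in>?U. \<xi> s0 \<noteq> 0"
  proof (rule ccontr)
    assume "\<not> ?thesis"
    then have "diag_block S \<xi> = 0" unfolding diag_block_def using fU by (simp add: vec_eq_iff)
    then show False using param_nonzero unfolding param_mat_def by simp
  qed
  then obtain s0 where s0: "s0 \<in> ?U" "\<xi> s0 \<noteq> 0" by blast
  define c where "c = inverse (\<xi> s0)"
  have c: "c \<noteq> 0" unfolding c_def using s0 by simp
  define \<xi>' where "\<xi>' = (\<lambda>s. if s \<in> ?U then c * \<xi> s else if s \<in> coords S then \<xi> s else 1)"
  have diag: "diag_block S \<xi>' = c *\<^sub>R diag_block S \<xi>"
    unfolding diag_block_def \<xi>'_def using fU by (auto simp: vec_eq_iff)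
  have off: "off_block S \<xi>' = off_block S \<xi>"
    unfolding off_block_def \<xi>'_def by (auto simp: vec_eq_iff coords_def)
  have "param_mat S \<xi>' = c *\<^sub>R param_mat S \<xi>"
    unfolding param_mat_def diag off by (simp add: scalar_mult_eq_scaleR[symmetric] matrix_scalar_ac scalar_matrix_assoc)
  moreover have "conormal S N \<xi>' = conormal S N \<xi>" unfolding conormal_def off ..
  ultimately have "has_conormal S N L \<xi>'" using has_conormal c subspace_scale[OF L] unfolding has_conormal_def by simp
  moreover have "\<xi>' s = 1" if "s \<notin> coords S - {s0}" for s
    using that s0 unfolding \<xi>'_def c_def coords_def by auto
  moreover have "s0 \<in> coords S" using s0 unfolding coords_def by blast
  ultimately show ?thesis using that by blast
qed

text \<open>The number of parameters of matrices of rank \<open>card S\<close> and the number of parameters of their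
  conormal matrices add up to the dimension of the space of symmetric matrices; this duality is what
  makes the critical case thin.\<close>
lemma card_coords_conormal:
  fixes S :: "'n::finite set"
  shows "card (coords S) + card (upper \<inter> (- S) \<times> (- S)) = card (upper :: ('n \<times> 'n) set)"
proof -
  define r d u \<nu> N where "r = card S" and "d = card (- S)" and "u = card (upper \<inter> S \<times> S)"
    and "\<nu> = card (upper \<inter> (- S) \<times> (- S))" and "N = card (upper :: ('n \<times> 'n) set)"
  have n: "CARD('n) = r + d" unfolding r_def d_def
    by (metis card_Un_disjoint finite Compl_disjoint Compl_partition)
  have "2 * u = r * (r + 1)" "2 * \<nu> = d * (d + 1)" "2 * N = (r + d) * (r + d + 1)"
    using card_upper_block[of S] card_upper_block[of "- S"] card_upper[where 'n = 'n]
    unfolding u_def \<nu>_def N_def r_def d_def n[unfolded r_def d_def] by simp_all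
  then have "u + d * r + \<nu> = N" by (simp add: algebra_simps)
  then show ?thesis unfolding card_coords u_def \<nu>_def N_def r_def d_def by simp
qed

text \<open>The family \<open>A1\<close> covers the subspaces with a critical \<open>\<Omega>\<close>, indexed by \<open>S\<close> and the coordinate \<open>s0\<close>
  normalized to 1, and \<open>A2\<close> covers the others, indexed by \<open>S\<close> and the coordinates \<open>K\<close> of the box. For
  \<open>A1\<close> the parameter count is \<open>card_coords_conormal\<close>, for \<open>A2\<close> it is the hypothesis \<open>m\<close>.\<close>
lemma thin_exceptional:
  fixes I :: "'m::finite \<Rightarrow> 'n::finite \<times> 'n"
  assumes I: "inj I" "range I \<subseteq> upper" and r: "r \<ge> 1"
    and m: "\<And>S :: 'n set. card S = r \<Longrightarrow> card (upper - S \<times> S) < CARD('m)"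
  shows "thin ((upper - range I) \<times> UNIV) {a. (\<exists>\<Omega>\<in>chart_space I a. psd \<Omega> \<and> rank \<Omega> = r) \<and>
    (\<forall>\<Omega>\<in>chart_space I a. psd \<Omega> \<and> rank \<Omega> = r \<longrightarrow> \<not> Z_transversal \<Omega> (chart_space I a))}" (is "thin ?V ?E")
proof -
  define p where "p = card (upper - range I)"
  have "card (range I) = CARD('m)" by (rule card_image[OF I(1)])
  then have pm: "card (upper :: ('n \<times> 'n) set) = p + CARD('m)"
    unfolding p_def using I(2) card_mono[OF _ I(2)] by (simp add: card_Diff_subset)
  define N1 N2 where "N1 = (\<lambda>S :: 'n set. upper \<inter> (- S) \<times> (- S))" and "N2 = (\<lambda>S :: 'n set. upper - S \<times> S)"
  define A1 where "A1 = (\<lambda>(S, s0). {a. \<exists>\<xi>. (\<forall>s. s \<notin> coords S - {s0} \<longrightarrow> \<xi> s = 1) \<and> has_conormal S (N1 S) (chart_space I a) \<xi>})"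
  define Z where "Z = (\<lambda>(S, K). {(a, t). \<exists>\<xi>. (\<forall>c\<in>K. \<xi> c = t c) \<and> (\<forall>s. s \<notin> coords S \<longrightarrow> \<xi> s = 1) \<and>
      has_conormal S (N2 S) (chart_space I a) \<xi>})"
  define A2 where "A2 = (\<lambda>v. {a. \<exists>t0 e. e > 0 \<and> (\<forall>t. (\<forall>c\<in>snd v. \<bar>t c - t0 c\<bar> < e) \<longrightarrow> (a, t) \<in> Z v)})"
  have p_m: "p * CARD('m) = (p - 1) * (CARD('m) - 1) + p + CARD('m) - 1" if p0: "p > 0"
  proof -
    obtain p' where "p = Suc p'" using gr0_implies_Suc[OF p0] by blast
    moreover obtain m' where "CARD('m) = Suc m'"
      using gr0_implies_Suc[OF zero_less_card_finite[where 'a = 'm]] by blast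
    ultimately show ?thesis by simp
  qed
  have thin1: "thin ?V (A1 (S, s0))" if "s0 \<in> coords S" for S s0
  proof -
    have "thin (?V <+> {}) {case_sum a t |a t. (a, t) \<in> {(a, t). \<exists>\<xi>. (\<forall>c\<in>{}. \<xi> c = t c) \<and>
        (\<forall>s. s \<notin> coords S - {s0} \<longrightarrow> \<xi> s = 1) \<and> has_conormal S (N1 S) (chart_space I a) \<xi>}}"
    proof (rule thin_has_conormal[OF I])
      assume ne: "upper - range I \<noteq> {}"
      then have "p > 0" unfolding p_def by (simp add: card_gt_0_iff)
      moreover have "card (coords S - {s0}) + 1 = card (coords S)" "card (coords S) > 0"
        using card_Suc_Diff1[of "coords S" s0] that by (simp_all add: card_gt_0_iff) auto
      moreover have "card (coords S) + card (N1 S) = p + CARD('m)"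
        using card_coords_conormal[of S] pm unfolding N1_def by simp
      ultimately show "card (coords S - {s0}) + card (N1 S) + (card (upper - range I) - 1) * (CARD('m) - 1)
          \<le> card (upper - range I) * CARD('m) + card ({} :: ('n \<times> 'n) set)"
        using p_m unfolding p_def[symmetric] by simp
    qed
    from thin_project_Inl[OF this] show ?thesis unfolding A1_def by (rule thin_subset) auto
  qed
  have thin2: "thin ?V (A2 (S, K))" if S: "card S = r" and K: "card K + p = card (coords S)" for S K
  proof -
    have "thin (?V <+> K) {case_sum a t |a t. (a, t) \<in> {(a, t). \<exists>\<xi>. (\<forall>c\<in>K. \<xi> c = t c) \<and>
        (\<forall>s. s \<notin> coords S \<longrightarrow> \<xi> s = 1) \<and> has_conormal S (N2 S) (chart_space I a) \<xi>}}"
    proof (rule thin_has_conormal[OF I])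
      assume ne: "upper - range I \<noteq> {}"
      then have "p > 0" unfolding p_def by (simp add: card_gt_0_iff)
      then show "card (coords S) + card (N2 S) + (card (upper - range I) - 1) * (CARD('m) - 1)
          \<le> card (upper - range I) * CARD('m) + card K"
        using p_m m[OF S] K unfolding p_def[symmetric] N2_def by simp
    qed
    from thin_slice[OF this] show ?thesis unfolding A2_def Z_def by simp
  qed
  have "thin ?V ((\<Union>v\<in>{(S, s0). s0 \<in> coords S}. A1 v) \<union> (\<Union>v\<in>{(S, K). card S = r \<and> card K + p = card (coords S)}. A2 v))"
    using thin1 thin2 by (intro thin_Un thin_UN) auto
  moreover have "?E \<subseteq> (\<Union>v\<in>{(S, s0). s0 \<in> coords S}. A1 v) \<union> (\<Union>v\<in>{(S, K). card S = r \<and> card K + p = card (coords S)}. A2 v)"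
  proof
    fix a assume a: "a \<in> ?E"
    let ?L = "chart_space I a"
    have L: "subspace ?L" "?L \<subseteq> sym_mats" by (rule subspace_chart_space) (auto simp: chart_space_def)
    have non_transversal: "\<not> Z_transversal \<Omega> ?L" if "\<Omega> \<in> ?L" "psd \<Omega>" "rank \<Omega> = r" for \<Omega>
      using a that by blast
    obtain \<Omega> where \<Omega>: "\<Omega> \<in> ?L" "psd \<Omega>" "rank \<Omega> = r" using a by blast
    obtain S \<xi> where S: "card S = r" "param_mat S \<xi> = \<Omega>" "nondegenerate_on S \<xi>"
      using sym_factorization[of \<Omega>] \<Omega> unfolding psd_def by metis
    have pos: "positive_on S \<xi>" using psd_param_mat_imp_positive_on S \<Omega>(2) by metis
    have param_mat_nonzero: "param_mat S \<zeta> \<noteq> 0" if "nondegenerate_on S \<zeta>" for \<zeta>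
      using rank_param_mat[OF that] S(1) r by auto
    show "a \<in> (\<Union>v\<in>{(S, s0). s0 \<in> coords S}. A1 v) \<union> (\<Union>v\<in>{(S, K). card S = r \<and> card K + p = card (coords S)}. A2 v)"
    proof (cases "\<exists>Y\<in>sym_mats. Y \<noteq> 0 \<and> (\<forall>x\<in>?L. Y \<bullet> x = 0) \<and> (\<forall>c. Y \<bullet> param_deriv S \<xi> (\<lambda>p. if p = c then 1 else 0) = 0)")
      case True
      then obtain Y where Y: "Y \<in> sym_mats" "Y \<noteq> 0" "\<forall>x\<in>?L. Y \<bullet> x = 0" "\<And>c. Y \<bullet> param_deriv S \<xi> (\<lambda>p. if p = c then 1 else 0) = 0"
        by blast
      obtain \<eta> where "Y = conormal S (N1 S) \<xi> \<eta>"
        using critical_conormal[OF S(3) Y(1,4)] unfolding N1_def by blast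
      then have "has_conormal S (N1 S) ?L \<xi>" unfolding has_conormal_def using Y param_mat_nonzero[OF S(3)] \<Omega>(1) S(2) by blast
      then obtain s0 \<xi>' where s0: "s0 \<in> coords S" "\<And>s. s \<notin> coords S - {s0} \<Longrightarrow> \<xi>' s = 1" "has_conormal S (N1 S) ?L \<xi>'"
        using has_conormal_normalize[OF _ L(1)] by metis
      then have "a \<in> A1 (S, s0)" unfolding A1_def by blast
      then show ?thesis using s0(1) by blast
    next
      case False
      obtain K t0 e where K: "card K + p = card (coords S)" "e > 0"
        "\<And>t. (\<forall>c\<in>K. \<bar>t c - t0 c\<bar> < e) \<Longrightarrow> \<exists>\<xi>. (\<forall>c\<in>K. \<xi> c = t c) \<and> (\<forall>s. s \<notin> coords S \<longrightarrow> \<xi> s = 1) \<and>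
          positive_on S \<xi> \<and> param_mat S \<xi> \<in> ?L"
        using solutions_over_open_box[OF I pos, of a] False \<Omega>(1) S(2) unfolding p_def by blast
      have "has_conormal S (N2 S) ?L \<zeta>" if \<zeta>: "positive_on S \<zeta>" "param_mat S \<zeta> \<in> ?L" for \<zeta>
      proof -
        have nd: "nondegenerate_on S \<zeta>" by (rule positive_on_nondegenerate[OF \<zeta>(1)])
        have "\<not> Z_transversal (param_mat S \<zeta>) ?L"
          using non_transversal \<zeta>(2) psd_param_mat[OF \<zeta>(1)] rank_param_mat[OF nd] S(1) by simp
        from non_transversal_conormal[OF nd L this] show ?thesis
          unfolding has_conormal_def N2_def using \<zeta>(2) param_mat_nonzero[OF nd] by blast
      qed
      then have "(a, t) \<in> Z (S, K)" if "\<forall>c\<in>K. \<bar>t c - t0 c\<bar> < e" for t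
        using K(3)[OF that] unfolding Z_def by blast
      then have "a \<in> A2 (S, K)" unfolding A2_def using K(2) by auto
      then show ?thesis using S(1) K(1) by blast
    qed
  qed
  ultimately show ?thesis by (rule thin_subset)
qed

theorem lemma3p11:
  fixes d m n :: nat
    and E :: "(real ^ 'n::finite ^ 'n) set set"
  assumes n: "n = CARD('n)"
    and m: "m = CARD('m::finite)"
    and d: "1 \<le> d" "d \<le> n"
    and m_lower: "int d * int n - int (d choose 2) + 1 \<le> int m"
    and m_upper: "m \<le> (n + 1) choose 2"
    and E: "E = {L \<in> grassmannian m.
        (\<exists>\<Omega>\<in>L. psd \<Omega> \<and> rank \<Omega> = n - d) \<and>
        (\<forall>\<Omega>\<in>L. psd \<Omega> \<and> rank \<Omega> = n - d \<longrightarrow> \<not> Z_transversal \<Omega> L)}"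
  shows "\<exists>X. zariski_closed TYPE('m) X \<and> X \<subset> grassmannian m \<and> E \<subseteq> X"
proof -
  define r where "r = n - d"
  have nr: "n = r + d" unfolding r_def using d by simp
  have choose2: "2 * (k choose 2) = k * (k - 1)" for k :: nat
    by (cases k) (auto simp: choose_two even_two_times_div_two)
  have N: "2 * card (upper :: ('n \<times> 'n) set) = n * (n + 1)"
    using card_upper[where 'n = 'n] n by simp
  then have "card (upper :: ('n \<times> 'n) set) = (n + 1) choose 2"
    using choose2[of "n + 1"] by (simp add: mult.commute)
  then have "card (UNIV :: 'm set) \<le> card (upper :: ('n \<times> 'n) set)" using m m_upper by simp
  then obtain I :: "'m \<Rightarrow> 'n \<times> 'n" where I: "inj I" "range I \<subseteq> upper"
    using card_le_inj[of "UNIV :: 'm set" "upper :: ('n \<times> 'n) set"] by auto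
  have d2: "2 * int (d choose 2) = int d * int d - int d"
    using arg_cong[OF choose2[of d], of int] d(1) by (simp add: of_nat_diff algebra_simps)
  have codim: "card (upper - S \<times> S) < m" if S: "card S = r" for S :: "'n set"
  proof -
    have "card (upper - S \<times> S) + card (upper \<inter> S \<times> S) = card (upper :: ('n \<times> 'n) set)"
      using card_Int_Diff[of "upper :: ('n \<times> 'n) set" "S \<times> S"] by simp
    moreover have "2 * card (upper \<inter> S \<times> S) = r * (r + 1)" using card_upper_block[of S] S by simp
    ultimately have "2 * card (upper - S \<times> S) + r * (r + 1) = n * (n + 1)" using N by linarith
    from arg_cong[OF this, of int] have "2 * int (card (upper - S \<times> S)) + int r * (int r + 1) = int n * (int n + 1)"
      by (simp add: algebra_simps)
    then have "int (card (upper - S \<times> S)) = int d * int n - int (d choose 2)"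
      using d2 unfolding nr by (simp add: algebra_simps)
    then show ?thesis using m_lower by linarith
  qed
  have "r \<ge> 1"
  proof (rule ccontr)
    assume "\<not> r \<ge> 1"
    then have "card ({} :: 'n set) = r" by simp
    from codim[OF this] show False
      using \<open>card (UNIV :: 'm set) \<le> card (upper :: ('n \<times> 'n) set)\<close> m by simp
  qed
  from thin_exceptional[OF I this] codim m
  have "thin ((upper - range I) \<times> UNIV) {a. (\<exists>\<Omega>\<in>chart_space I a. psd \<Omega> \<and> rank \<Omega> = r) \<and>
    (\<forall>\<Omega>\<in>chart_space I a. psd \<Omega> \<and> rank \<Omega> = r \<longrightarrow> \<not> Z_transversal \<Omega> (chart_space I a))}" by simp
  then have "thin ((upper - range I) \<times> UNIV) {a. chart_space I a \<in> E}"
    by (rule thin_subset) (auto simp: E r_def)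
  then show ?thesis
    using thin_in_chart_imp_zariski[OF I, of E] E m by auto
qed

end
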